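(* Let $\ell\geq 6$ be an integer and let $G$ be an $\ell$-monoholed graph. Then one of the following holds: (a) $G$ contains a vertex adjacent to every other vertex of $G$; (b) $G$ contains a clique cutset; (c) $G$ is chordal; (d) $G$ is an inflated $\ell$-hole; (e) $G$ contains, as induced subgraphs, a pair of mated $k$-spiders for some $k\geq3$.
   Context: A hole is an induced cycle of length at least four; $G$ is $\ell$-monoholed if every hole of $G$ has length exactly $\ell$; chordal means no holes. A clique cutset is a set $X$ inducing a clique such that $G\setminus X$ is disconnected. For disjoint vertex sets $A,B$, a half-graph between $A$ and $B$ is a set of edges between $A$ and $B$ such that for any $a,a'\in A$ the neighbourhoods of $a,a'$ in $B$ are nested under inclusion (equivalently there is no induced two-edge matching between $A$ and $B$). Given half-graphs between $X,Y$ and between $Y,Z$ ($X,Y,Z$ disjoint), they are compatible with respect to $Y$ if in the graph formed by their union, the neighbourhoods of any two vertices of $Y$ are nested. An inflated $\ell$-hole is a graph obtained from a cycle $H$ of length $\ell$ by replacing each vertex $v$ by a nonempty clique $K_v$, adding for each edge $xy$ of $H$ a half-graph between $K_x$ and $K_y$ such that the bipartite graph it forms is connected, adding no edges between $K_x,K_y$ for non-adjacent $x,y$, and such that for every $v$ and its two neighbours $x,y$ in $H$ the half-graphs between $K_x,K_v$ and $K_y,K_v$ are compatible with respect to $K_v$. For $k\geq3$, a $k$-spider is a connected graph $S$ whose vertices of degree one are exactly $t_1,\dots,t_k$ (its toes) and which is minimal, i.e. no proper induced subgraph of $S$ containing all the toes is connected. Two $k$-spiders $S,S'$ are mates if they have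 the same set of toes, $V(S)\setminus\{t_1,\dots,t_k\}$ and $V(S')\setminus\{t_1,\dots,t_k\}$ are disjoint and anticomplete, and $d_S(t_i,t_j)+d_{S'}(t_i,t_j)=\ell$ for all distinct $i,j$, where $d_S$ is distance in $S$. *)

theory Defs
  imports Main "HOL-Library.Disjoint_Sets"
begin

text \<open>A simple graph is given by its vertex set and its edge set; an edge \<open>uv\<close> is stored as
  both ordered pairs.  All graphs are finite.\<close>

definition simple_graph :: "'a set \<Rightarrow> 'a rel \<Rightarrow> bool" where
  "simple_graph V E \<longleftrightarrow> finite V \<and> E \<subseteq> V \<times> V \<and> sym E \<and> irrefl E"

text \<open>The subgraph of \<open>(V, E)\<close> induced on \<open>S \<subseteq> V\<close> is \<open>(S, induced E S)\<close>.\<close>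

definition induced :: "'a rel \<Rightarrow> 'a set \<Rightarrow> 'a rel" where
  "induced E S = E \<inter> S \<times> S"

definition edges_between :: "'a rel \<Rightarrow> 'a set \<Rightarrow> 'a set \<Rightarrow> 'a rel" where
  "edges_between E A B = E \<inter> (A \<times> B \<union> B \<times> A)"

definition degree :: "'a rel \<Rightarrow> 'a \<Rightarrow> nat" where
  "degree E v = card (E `` {v})"

text \<open>The graph with no vertices counts as connected, so it is not disconnected
  and a clique cutset never consists of all vertices.\<close>

definition connected_graph :: "'a set \<Rightarrow> 'a rel \<Rightarrow> bool" where
  "connected_graph V E \<longleftrightarrow> (\<forall>u\<in>V. \<forall>v\<in>V. (u, v) \<in> E\<^sup>*)"

text \<open>Length of a shortest walk; only meaningful for vertices in the same component.\<close>

definition graph_dist :: "'a rel \<Rightarrow> 'a \<Rightarrow> 'a \<Rightarrow> nat" where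
  "graph_dist E u v = (LEAST n. (u, v) \<in> E ^^ n)"

definition clique :: "'a rel \<Rightarrow> 'a set \<Rightarrow> bool" where
  "clique E X \<longleftrightarrow> (\<forall>u\<in>X. \<forall>v\<in>X. u \<noteq> v \<longrightarrow> (u, v) \<in> E)"

definition clique_cutset :: "'a set \<Rightarrow> 'a rel \<Rightarrow> 'a set \<Rightarrow> bool" where
  "clique_cutset V E X \<longleftrightarrow>
     X \<subseteq> V \<and> clique E X \<and> \<not> connected_graph (V - X) (induced E (V - X))"

text \<open>Adjacency in the cycle of length \<open>n \<ge> 3\<close> with vertices \<open>0, \<dots>, n - 1\<close>.\<close>

definition cycle_adj :: "nat \<Rightarrow> nat \<Rightarrow> nat \<Rightarrow> bool" where
  "cycle_adj n i j \<longleftrightarrow> i < n \<and> j < n \<and> (j = Suc i mod n \<or> i = Suc j mod n)"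

text \<open>A hole is listed by its vertices in cyclic order; its length is the length of the list.\<close>

definition hole :: "'a set \<Rightarrow> 'a rel \<Rightarrow> 'a list \<Rightarrow> bool" where
  "hole V E c \<longleftrightarrow>
     4 \<le> length c \<and> distinct c \<and> set c \<subseteq> V \<and>
     (\<forall>i<length c. \<forall>j<length c. (c ! i, c ! j) \<in> E \<longleftrightarrow> cycle_adj (length c) i j)"

definition monoholed :: "nat \<Rightarrow> 'a set \<Rightarrow> 'a rel \<Rightarrow> bool" where
  "monoholed l V E \<longleftrightarrow> (\<forall>c. hole V E c \<longrightarrow> length c = l)"

definition chordal :: "'a set \<Rightarrow> 'a rel \<Rightarrow> bool" where
  "chordal V E \<longleftrightarrow> (\<nexists>c. hole V E c)"

definition half_graph :: "'a set \<Rightarrow> 'a set \<Rightarrow> 'a rel \<Rightarrow> bool" where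
  "half_graph A B F \<longleftrightarrow>
     F \<subseteq> A \<times> B \<union> B \<times> A \<and> sym F \<and>
     (\<forall>a\<in>A. \<forall>a'\<in>A. F `` {a} \<subseteq> F `` {a'} \<or> F `` {a'} \<subseteq> F `` {a})"

definition compatible :: "'a set \<Rightarrow> 'a rel \<Rightarrow> 'a rel \<Rightarrow> bool" where
  "compatible Y F F' \<longleftrightarrow>
     (\<forall>y\<in>Y. \<forall>y'\<in>Y. (F \<union> F') `` {y} \<subseteq> (F \<union> F') `` {y'} \<or> (F \<union> F') `` {y'} \<subseteq> (F \<union> F') `` {y})"

text \<open>\<open>K i\<close> is the clique replacing the vertex \<open>i\<close> of the cycle.\<close>

definition inflated_hole :: "nat \<Rightarrow> 'a set \<Rightarrow> 'a rel \<Rightarrow> bool" where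
  "inflated_hole l V E \<longleftrightarrow>
     3 \<le> l \<and>
     (\<exists>K :: nat \<Rightarrow> 'a set.
        V = (\<Union>i<l. K i) \<and> disjoint_family_on K {..<l} \<and>
        (\<forall>i<l. K i \<noteq> {} \<and> clique E (K i)) \<and>
        (\<forall>i<l. \<forall>j<l. cycle_adj l i j \<longrightarrow>
           half_graph (K i) (K j) (edges_between E (K i) (K j)) \<and>
           connected_graph (K i \<union> K j) (edges_between E (K i) (K j))) \<and>
        (\<forall>i<l. \<forall>j<l. i \<noteq> j \<and> \<not> cycle_adj l i j \<longrightarrow> edges_between E (K i) (K j) = {}) \<and>
        (\<forall>v<l. \<forall>x<l. \<forall>y<l. x \<noteq> y \<and> cycle_adj l v x \<and> cycle_adj l v y \<longrightarrow>
           compatible (K v) (edges_between E (K x) (K v)) (edges_between E (K y) (K v))))"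

text \<open>\<open>spider k S E T\<close>: the graph \<open>(S, E)\<close> is a \<open>k\<close>-spider with set of toes \<open>T\<close>.\<close>

definition spider :: "nat \<Rightarrow> 'a set \<Rightarrow> 'a rel \<Rightarrow> 'a set \<Rightarrow> bool" where
  "spider k S E T \<longleftrightarrow>
     3 \<le> k \<and> simple_graph S E \<and> connected_graph S E \<and>
     {v \<in> S. degree E v = 1} = T \<and> card T = k \<and>
     (\<forall>S'. T \<subseteq> S' \<and> S' \<subset> S \<longrightarrow> \<not> connected_graph S' (induced E S'))"

text \<open>The spiders are the subgraphs induced on \<open>S\<close> and \<open>S'\<close> in an ambient graph with edge set
  \<open>E\<close>; \<open>T\<close> is their common set of toes.  Anticompleteness refers to the ambient graph.\<close>

definition mated_spiders :: "nat \<Rightarrow> nat \<Rightarrow> 'a rel \<Rightarrow> 'a set \<Rightarrow> 'a set \<Rightarrow> 'a set \<Rightarrow> bool" where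
  "mated_spiders l k E S S' T \<longleftrightarrow>
     spider k S (induced E S) T \<and> spider k S' (induced E S') T \<and>
     (S - T) \<inter> (S' - T) = {} \<and> edges_between E (S - T) (S' - T) = {} \<and>
     (\<forall>s\<in>T. \<forall>t\<in>T. s \<noteq> t \<longrightarrow>
        graph_dist (induced E S) s t + graph_dist (induced E S') s t = l)"

end

theory Submission
  imports Defs
begin

text \<open>Already three-toed mated spiders suffice.  Choose a largest induced subgraph \<open>W\<close> that is a ring: cliques
  arranged in a cycle of length \<open>l\<close>, with edges only inside and between consecutive cliques, every
  vertex having neighbours in both adjacent cliques.  As all holes have length \<open>l\<close>, a ring is an
  inflated hole, and a vertex outside \<open>W\<close> either is complete to \<open>W\<close> or has a clique of neighbours
  in \<open>W\<close> (or, for \<open>l = 6\<close>, completes a prism).  Let \<open>U\<close> be the clique of vertices complete to \<open>W\<close>.  A component of the remaining vertices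
  whose attachments to \<open>W\<close> form a clique gives, together with \<open>U\<close>, a clique cutset.  Otherwise a shortest
  path through it between nonadjacent vertices of \<open>W\<close> closes up with a hole to a theta, pyramid or
  prism; cutting this configuration at one inner vertex of each of its three paths leaves two mated
  spiders.  If no vertices remain, \<open>U\<close> consists of universal vertices, or is empty and the graph is
  an inflated hole.\<close>

section \<open>Cycles and induced paths\<close>

text \<open>The conditions on a ring are kept weak so that they are easy to check when a vertex is
  inserted; half-graphs and compatibility are derived from hole lengths afterwards. The working tool
  is a by-product of that derivation: inside a clique the neighbourhoods towards the two adjacent
  cliques form a chain, so each clique contains a vertex complete to both adjacent cliques. With
  these core vertices as filler, any vertex of the ring, or any two from distinct nonconsecutive
  cliques, lie on a common hole, and a question about the ring becomes one about a single cycle. The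
  obstacle is a pair of nonadjacent vertices in consecutive cliques: no hole with one vertex per
  clique contains both. Such pairs are handled by the path of \<open>l\<close> vertices joining them
  the long way round, which closes up to a hole that is too long or leaves one of length 4 or 5. The
  bound \<open>l \<ge> 6\<close> excludes holes of length 4 and 5, and it makes both arcs between
  the attachments of a path long enough to have an inner vertex, which becomes a toe.\<close>

lemma cycle_adj_iff:
  assumes "3 \<le> n"
  shows "cycle_adj n i j \<longleftrightarrow> i < n \<and> j < n \<and>
    (j = Suc i \<or> i = Suc j \<or> i = 0 \<and> j = n - 1 \<or> j = 0 \<and> i = n - 1)"
proof -
  have "Suc k mod n = (if Suc k = n then 0 else Suc k)" if "k < n" for k
    using that assms by auto
  then show ?thesis
    unfolding cycle_adj_def using assms by (cases "Suc i = n"; cases "Suc j = n") auto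
qed

lemma cycle_adj_sym: "cycle_adj n i j \<longleftrightarrow> cycle_adj n j i"
  unfolding cycle_adj_def by auto

text \<open>The bound \<open>j \<le> i + n - 2\<close> excludes the wrap-around edge, so a stretch
  of the cycle read modulo \<open>n\<close> behaves like a path even when it crosses index
  0.\<close>

lemma cycle_adj_mod:
  assumes "3 \<le> n" "i < j" "j + 2 \<le> i + n"
  shows "i mod n \<noteq> j mod n" "cycle_adj n (i mod n) (j mod n) \<longleftrightarrow> j = Suc i"
proof -
  have eq: "a = b" if "a mod n = b mod n" "a \<le> b" "b < a + n" for a b :: nat
  proof -
    have "n dvd b - a"
      using that by (metis mod_eq_dvd_iff_nat)
    then show ?thesis
      using that by (metis dvd_imp_le add.commute diff_is_0_eq le_antisym less_diff_conv2 not_less zero_less_iff_neq_zero)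
  qed
  show "i mod n \<noteq> j mod n"
    using eq[of i j] assms by auto
  have "cycle_adj n (i mod n) (j mod n) \<longleftrightarrow>
      j mod n = Suc i mod n \<or> i mod n = Suc j mod n"
    using assms unfolding cycle_adj_def by (simp add: mod_Suc_eq)
  moreover have "j mod n = Suc i mod n \<longleftrightarrow> j = Suc i"
    using eq[of "Suc i" j] assms by auto
  moreover have "i mod n \<noteq> Suc j mod n"
    using eq[of i "Suc j"] assms by auto
  ultimately show "cycle_adj n (i mod n) (j mod n) \<longleftrightarrow> j = Suc i"
    by auto
qed

section \<open>Automorphisms of the cycle\<close>

definition cycle_aut :: "nat \<Rightarrow> (nat \<Rightarrow> nat) \<Rightarrow> bool" where
  "cycle_aut n \<sigma> \<longleftrightarrow> bij_betw \<sigma> {..<n} {..<n} \<and>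
     (\<forall>i<n. \<forall>j<n. cycle_adj n (\<sigma> i) (\<sigma> j) \<longleftrightarrow> cycle_adj n i j)"

lemma cycle_autD:
  assumes "cycle_aut n \<sigma>"
  shows "i < n \<Longrightarrow> \<sigma> i < n"
    and "i < n \<Longrightarrow> j < n \<Longrightarrow> \<sigma> i = \<sigma> j \<longleftrightarrow> i = j"
    and "i < n \<Longrightarrow> j < n \<Longrightarrow> cycle_adj n (\<sigma> i) (\<sigma> j) \<longleftrightarrow> cycle_adj n i j"
    and "i < n \<Longrightarrow> \<exists>k<n. \<sigma> k = i"
    and "\<sigma> ` {..<n} = {..<n}"
proof -
  have b: "bij_betw \<sigma> {..<n} {..<n}"
    using assms unfolding cycle_aut_def by blast
  show "i < n \<Longrightarrow> \<sigma> i < n" "i < n \<Longrightarrow> \<exists>k<n. \<sigma> k = i" "\<sigma> ` {..<n} = {..<n}"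
    using b unfolding bij_betw_def by (auto simp: set_eq_iff image_iff Bex_def) metis
  show "i < n \<Longrightarrow> j < n \<Longrightarrow> \<sigma> i = \<sigma> j \<longleftrightarrow> i = j"
    using b unfolding bij_betw_def inj_on_def by auto
  show "i < n \<Longrightarrow> j < n \<Longrightarrow> cycle_adj n (\<sigma> i) (\<sigma> j) \<longleftrightarrow> cycle_adj n i j"
    using assms unfolding cycle_aut_def by blast
qed

text \<open>Serves every reduction by symmetry below: a given edge of the cycle is moved to the
  indices 0 and 1, by a rotation or by a reflection according to its direction.\<close>

lemma cycle_aut_exists:
  assumes "3 \<le> n" "cycle_adj n i j"
  obtains \<sigma> where "cycle_aut n \<sigma>" "\<sigma> 0 = i" "\<sigma> 1 = j"
proof -
  have ij: "i < n" "j < n"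
    using assms unfolding cycle_adj_def by auto
  have aut: "cycle_aut n \<sigma>"
    if "\<And>k. k < n \<Longrightarrow> \<sigma> k < n" "inj_on \<sigma> {..<n}"
      "\<And>a b. a < n \<Longrightarrow> b < n \<Longrightarrow> cycle_adj n (\<sigma> a) (\<sigma> b) \<longleftrightarrow> cycle_adj n a b" for \<sigma>
  proof -
    have "\<sigma> ` {..<n} = {..<n}"
      using that by (intro endo_inj_surj) auto
    then show ?thesis
      using that unfolding cycle_aut_def bij_betw_def by blast
  qed
  show thesis
  proof (cases "j = Suc i mod n")
    case True
    define \<sigma> where "\<sigma> k = (if i + k < n then i + k else i + k - n)" for k
    have "cycle_aut n \<sigma>"
    proof (rule aut)
      show "inj_on \<sigma> {..<n}"
        unfolding \<sigma>_def inj_on_def using ij by auto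
      show "cycle_adj n (\<sigma> a) (\<sigma> b) \<longleftrightarrow> cycle_adj n a b" if "a < n" "b < n" for a b
        unfolding cycle_adj_iff[OF assms(1)] \<sigma>_def using ij that assms(1) by auto
    qed (use ij in \<open>auto simp: \<sigma>_def\<close>)
    moreover have "\<sigma> 0 = i" "\<sigma> 1 = j"
      unfolding \<sigma>_def using True ij assms(1) by (auto simp: mod_Suc)
    ultimately show thesis
      using that by blast
  next
    case False
    then have i: "i = Suc j mod n"
      using assms unfolding cycle_adj_def by auto
    \<comment> \<open>This reflection is its own inverse, so preserving adjacency in one direction
      already gives the equivalence.\<close>
    define \<sigma> where "\<sigma> k = (if k \<le> i then i - k else i + n - k)" for k
    have lt: "\<sigma> k < n" and inv: "\<sigma> (\<sigma> k) = k" if "k < n" for k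
      using that ij unfolding \<sigma>_def by auto
    have fwd: "cycle_adj n (\<sigma> a) (\<sigma> b)" if ab: "cycle_adj n a b" for a b
    proof -
      consider "a < n" "b = Suc a" "b < n" | "b < n" "a = Suc b" "a < n"
        | "a = 0" "b = n - 1" | "b = 0" "a = n - 1"
        using ab unfolding cycle_adj_iff[OF assms(1)] by blast
      then show ?thesis
        by cases (use ij assms(1) in \<open>auto simp: cycle_adj_iff \<sigma>_def\<close>)
    qed
    have "cycle_aut n \<sigma>"
    proof (rule aut)
      show "inj_on \<sigma> {..<n}"
        by (rule inj_on_inverseI[where g = \<sigma>]) (use inv in auto)
      show "cycle_adj n (\<sigma> a) (\<sigma> b) \<longleftrightarrow> cycle_adj n a b" if "a < n" "b < n" for a b
        using fwd[of a b] fwd[of "\<sigma> a" "\<sigma> b"] inv that by auto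
    qed (use lt in auto)
    moreover have "\<sigma> 0 = i" "\<sigma> 1 = j"
      unfolding \<sigma>_def using i ij assms(1) by (auto simp: mod_Suc split: if_splits)
    ultimately show thesis
      using that by blast
  qed
qed

text \<open>Here \<open>n\<close> counts vertices, not edges: a path of length \<open>d\<close> has
  parameter \<open>Suc d\<close>. Only pairs \<open>i < j\<close> are constrained; symmetry of
  \<open>E\<close> covers the others.\<close>

definition induced_path :: "'a rel \<Rightarrow> nat \<Rightarrow> (nat \<Rightarrow> 'a) \<Rightarrow> bool" where
  "induced_path E n p \<longleftrightarrow>
     (\<forall>i<n. \<forall>j<n. i < j \<longrightarrow> p i \<noteq> p j \<and> ((p i, p j) \<in> E \<longleftrightarrow> j = Suc i))"

lemma induced_pathD:
  assumes "induced_path E n p" "i < j" "j < n"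
  shows "p i \<noteq> p j" "(p i, p j) \<in> E \<longleftrightarrow> j = Suc i"
  using assms unfolding induced_path_def by auto

lemma induced_path_shift:
  assumes "induced_path E n p" "k + m \<le> n"
  shows "induced_path E m (\<lambda>i. p (k + i))"
  using assms unfolding induced_path_def by auto

lemma induced_path_rev:
  assumes "induced_path E n p" "sym E"
  shows "induced_path E n (\<lambda>i. p (n - 1 - i))"
  unfolding induced_path_def
proof (intro allI impI)
  fix i j assume ij: "i < n" "j < n" "i < j"
  then have "n - 1 - j < n - 1 - i" "n - 1 - i < n" by auto
  from induced_pathD[OF assms(1) this]
  have "p (n - 1 - j) \<noteq> p (n - 1 - i)"
    "(p (n - 1 - j), p (n - 1 - i)) \<in> E \<longleftrightarrow> n - 1 - i = Suc (n - 1 - j)"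
    by auto
  moreover have "n - 1 - i = Suc (n - 1 - j) \<longleftrightarrow> j = Suc i"
    using ij by auto
  ultimately show "p (n - 1 - i) \<noteq> p (n - 1 - j) \<and>
      ((p (n - 1 - i), p (n - 1 - j)) \<in> E \<longleftrightarrow> j = Suc i)"
    using assms(2) by (metis symD)
qed

text \<open>A repeated vertex or a chord would give a shorter walk. The length is expressed by
  \<open>graph_dist\<close> because the same lemma yields the paths between toes, whose lengths
  occur in the definition of mates.\<close>

lemma shortest_path:
  assumes "(a, b) \<in> (induced E S)\<^sup>*" "a \<in> S"
  obtains p where "p 0 = a" "p (graph_dist (induced E S) a b) = b"
    "\<And>i. i \<le> graph_dist (induced E S) a b \<Longrightarrow> p i \<in> S"
    "induced_path E (Suc (graph_dist (induced E S) a b)) p"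
proof -
  let ?R = "induced E S" and ?n = "graph_dist (induced E S) a b"
  have "\<exists>n. (a, b) \<in> ?R ^^ n"
    using assms(1) by (simp add: rtrancl_power)
  then have "(a, b) \<in> ?R ^^ ?n"
    unfolding graph_dist_def by (rule LeastI_ex)
  then obtain p where p: "p 0 = a" "p ?n = b" "\<And>i. i < ?n \<Longrightarrow> (p i, p (Suc i)) \<in> ?R"
    unfolding relpow_fun_conv by auto
  have least: "?n \<le> k" if "(a, b) \<in> ?R ^^ k" for k
    unfolding graph_dist_def using that by (rule Least_le)
  have S: "p i \<in> S" if "i \<le> ?n" for i
    using p(1,3) that assms(2) by (cases i) (auto simp: induced_def)
  have seg: "(p i, p j) \<in> ?R ^^ (j - i)" if "i \<le> j" "j \<le> ?n" for i j
    unfolding relpow_fun_conv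
    by (rule exI[of _ "\<lambda>k. p (i + k)"]) (use that p(3) in auto)
  have "p i \<noteq> p j \<and> ((p i, p j) \<in> E \<longleftrightarrow> j = Suc i)" if ij: "i < j" "j \<le> ?n" for i j
  proof (intro conjI iffI notI)
    have 1: "(a, p i) \<in> ?R ^^ i" "(p j, b) \<in> ?R ^^ (?n - j)"
      using seg[of 0 i] seg[of j ?n] ij p by auto
    show False if "p i = p j"
    proof -
      have "(a, b) \<in> ?R ^^ (i + (?n - j))"
        using 1 that unfolding relpow_add by auto
      from least[OF this] show ?thesis
        using ij by auto
    qed
    show "j = Suc i" if "(p i, p j) \<in> E"
    proof -
      have "(p i, p j) \<in> ?R"
        using that S ij by (auto simp: induced_def)
      then have "(a, p j) \<in> ?R ^^ Suc i"
        using 1 by auto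
      then have "(a, b) \<in> ?R ^^ (Suc i + (?n - j))"
        using 1 unfolding relpow_add by auto
      from least[OF this] show ?thesis
        using ij by auto
    qed
    show "(p i, p j) \<in> E" if "j = Suc i"
      using p(3)[of i] that ij by (auto simp: induced_def)
  qed
  then have "induced_path E (Suc ?n) p"
    unfolding induced_path_def by auto
  with p S that show thesis by blast
qed

section \<open>Holes in a monoholed graph\<close>

locale monoholed_graph =
  fixes l :: nat and V :: "'a set" and E :: "'a rel"
  assumes l6: "6 \<le> l" and simple: "simple_graph V E" and mono: "monoholed l V E"
begin

lemma adj_commute: "(u, v) \<in> E \<longleftrightarrow> (v, u) \<in> E"
  using simple unfolding simple_graph_def sym_def by blast

lemma sym_E: "sym E" and irrefl_E [simp]: "(u, u) \<notin> E" and finite_V: "finite V"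
  using simple unfolding simple_graph_def irrefl_def by auto

lemma adj_in_V: "(u, v) \<in> E \<Longrightarrow> u \<in> V" "(u, v) \<in> E \<Longrightarrow> v \<in> V"
  using simple unfolding simple_graph_def by auto

text \<open>Replaces lists by functions: only pairs \<open>i < j\<close> have to be inspected, and
  membership in \<open>V\<close> follows from the edges.\<close>

lemma hole_length:
  assumes "4 \<le> n"
    and c: "\<And>i j. i < j \<Longrightarrow> j < n \<Longrightarrow>
      c i \<noteq> c j \<and> ((c i, c j) \<in> E \<longleftrightarrow> j = Suc i \<or> i = 0 \<and> j = n - 1)"
  shows "n = l"
proof -
  have adj: "(c i, c j) \<in> E \<longleftrightarrow> cycle_adj n i j" if "i < n" "j < n" for i j
  proof (cases i j rule: linorder_cases)
    case less
    then show ?thesis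
      using c[of i j] that assms(1) by (auto simp: cycle_adj_iff)
  next
    case equal
    then show ?thesis
      using assms(1) by (auto simp: cycle_adj_iff)
  next
    case greater
    then show ?thesis
      using c[of j i] that assms(1) adj_commute[of "c i" "c j"] by (auto simp: cycle_adj_iff)
  qed
  have "c i \<in> V" if "i < n" for i
  proof -
    have "cycle_adj n i (Suc i mod n)"
      using that unfolding cycle_adj_def by auto
    then show ?thesis
      using adj[of i "Suc i mod n"] that adj_in_V by auto
  qed
  moreover have "inj_on c {0..<n}"
    by (rule linorder_inj_onI) (use c in auto)
  ultimately have "hole V E (map c [0..<n])"
    using adj assms(1) unfolding hole_def by (auto simp: distinct_map)
  then show ?thesis
    using mono unfolding monoholed_def by force
qed

text \<open>Most length equations below come from this gluing of two paths by two edges, last to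
  first and first to last. The case \<open>m = 1\<close> is included: the single vertex then counts
  as both ends and sees exactly the two ends of the other path.\<close>

lemma join_paths:
  assumes p: "induced_path E m p" and q: "induced_path E n q"
    and mn: "4 \<le> m + n" "1 \<le> m" "1 \<le> n"
    and pq: "\<And>i j. i < m \<Longrightarrow> j < n \<Longrightarrow> p i \<noteq> q j \<and>
      ((p i, q j) \<in> E \<longleftrightarrow> i = m - 1 \<and> j = 0 \<or> i = 0 \<and> j = n - 1)"
  shows "m + n = l"
proof (rule hole_length[where c = "\<lambda>i. if i < m then p i else q (i - m)"])
  fix i j assume ij: "i < j" "j < m + n"
  consider "j < m" | "i < m" "m \<le> j" | "m \<le> i"
    using ij by linarith
  then show "(if i < m then p i else q (i - m)) \<noteq> (if j < m then p j else q (j - m)) \<and>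
       ((if i < m then p i else q (i - m), if j < m then p j else q (j - m)) \<in> E \<longleftrightarrow>
        j = Suc i \<or> i = 0 \<and> j = m + n - 1)"
  proof cases
    case 1
    then show ?thesis
      using induced_pathD[OF p, of i j] ij mn by auto
  next
    case 2
    then have "i = m - 1 \<and> j - m = 0 \<or> i = 0 \<and> j - m = n - 1 \<longleftrightarrow>
        j = Suc i \<or> i = 0 \<and> j = m + n - 1"
      using ij mn by auto
    with 2 show ?thesis
      using pq[of i "j - m"] ij by auto
  next
    case 3
    then have "i - m < j - m" "j - m < n"
      using ij by auto
    from induced_pathD[OF q this] show ?thesis
      using 3 ij mn by auto
  qed
qed (use mn in auto)

lemma no_hole4:
  assumes "(a, b) \<in> E" "(b, c) \<in> E" "(c, d) \<in> E" "(d, a) \<in> E"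
    "(a, c) \<notin> E" "(b, d) \<notin> E" "a \<noteq> c" "b \<noteq> d"
  shows False
proof -
  have ad: "(a, d) \<in> E"
    using assms adj_commute by blast
  have "4 = l"
  proof (rule hole_length[where c = "\<lambda>i. [a, b, c, d] ! i"])
    fix i j :: nat assume "i < j" "j < 4"
    then have "i = 0 \<and> (j = 1 \<or> j = 2 \<or> j = 3) \<or> i = 1 \<and> (j = 2 \<or> j = 3) \<or> i = 2 \<and> j = 3"
      by auto
    then show "[a, b, c, d] ! i \<noteq> [a, b, c, d] ! j \<and>
        (([a, b, c, d] ! i, [a, b, c, d] ! j) \<in> E \<longleftrightarrow> j = Suc i \<or> i = 0 \<and> j = 4 - 1)"
      using assms ad by (elim disjE conjE; simp) auto
  qed auto
  then show False using l6 by auto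
qed

text \<open>Distinctness needs no hypothesis here, unlike for length 4: two nonconsecutive vertices
  of a 5-cycle are told apart by a vertex adjacent to only one of them.\<close>

lemma no_hole5:
  assumes "(a, b) \<in> E" "(b, c) \<in> E" "(c, d) \<in> E" "(d, e) \<in> E" "(e, a) \<in> E"
    "(a, c) \<notin> E" "(a, d) \<notin> E" "(b, d) \<notin> E" "(b, e) \<notin> E" "(c, e) \<notin> E"
  shows False
proof -
  have ae: "(a, e) \<in> E"
    using assms adj_commute by blast
  have "5 = l"
  proof (rule hole_length[where c = "\<lambda>i. [a, b, c, d, e] ! i"])
    fix i j :: nat assume "i < j" "j < 5"
    then have "i = 0 \<and> (j = 1 \<or> j = 2 \<or> j = 3 \<or> j = 4) \<or> i = 1 \<and> (j = 2 \<or> j = 3 \<or> j = 4) \<or>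
        i = 2 \<and> (j = 3 \<or> j = 4) \<or> i = 3 \<and> j = 4"
      by auto
    moreover have "a \<noteq> c" "a \<noteq> d" "b \<noteq> d" "b \<noteq> e" "c \<noteq> e"
      using assms adj_commute by metis+
    ultimately show "[a, b, c, d, e] ! i \<noteq> [a, b, c, d, e] ! j \<and>
        (([a, b, c, d, e] ! i, [a, b, c, d, e] ! j) \<in> E \<longleftrightarrow> j = Suc i \<or> i = 0 \<and> j = 5 - 1)"
      using assms ae by (elim disjE conjE; simp) auto
  qed auto
  then show False using l6 by auto
qed

lemma hole6:
  assumes "(a, b) \<in> E" "(b, c) \<in> E" "(c, d) \<in> E" "(d, e) \<in> E" "(e, f) \<in> E" "(f, a) \<in> E"
    "(a, c) \<notin> E" "(a, d) \<notin> E" "(a, e) \<notin> E" "(b, d) \<notin> E" "(b, e) \<notin> E" "(b, f) \<notin> E"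
    "(c, e) \<notin> E" "(c, f) \<notin> E" "(d, f) \<notin> E"
  shows "l = 6"
proof -
  have af: "(a, f) \<in> E"
    using assms adj_commute by blast
  have "6 = l"
  proof (rule hole_length[where c = "\<lambda>i. [a, b, c, d, e, f] ! i"])
    fix i j :: nat assume "i < j" "j < 6"
    then have "i = 0 \<and> (j = 1 \<or> j = 2 \<or> j = 3 \<or> j = 4 \<or> j = 5) \<or>
        i = 1 \<and> (j = 2 \<or> j = 3 \<or> j = 4 \<or> j = 5) \<or>
        i = 2 \<and> (j = 3 \<or> j = 4 \<or> j = 5) \<or> i = 3 \<and> (j = 4 \<or> j = 5) \<or> i = 4 \<and> j = 5"
      by auto
    moreover have "a \<noteq> c" "a \<noteq> d" "a \<noteq> e" "b \<noteq> d" "b \<noteq> e" "b \<noteq> f" "c \<noteq> e" "c \<noteq> f" "d \<noteq> f"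
      using assms adj_commute by metis+
    ultimately show "[a, b, c, d, e, f] ! i \<noteq> [a, b, c, d, e, f] ! j \<and>
        (([a, b, c, d, e, f] ! i, [a, b, c, d, e, f] ! j) \<in> E \<longleftrightarrow> j = Suc i \<or> i = 0 \<and> j = 6 - 1)"
      using assms af by (elim disjE conjE; simp) auto
  qed auto
  then show ?thesis by simp
qed

end

section \<open>Mated spiders\<close>

lemma induced_induced: "S' \<subseteq> S \<Longrightarrow> induced (induced E S) S' = induced E S'"
  unfolding induced_def by auto

lemma rtrancl_induced_mono: "S' \<subseteq> S \<Longrightarrow> (induced E S')\<^sup>* \<subseteq> (induced E S)\<^sup>*"
  unfolding induced_def by (intro rtrancl_mono) auto

lemma rtrancl_induced_commute:
  assumes "sym E"
  shows "(u, v) \<in> (induced E S)\<^sup>* \<longleftrightarrow> (v, u) \<in> (induced E S)\<^sup>*"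
proof -
  have "sym (induced E S)"
    using assms unfolding induced_def sym_def by auto
  then show ?thesis
    using sym_rtrancl unfolding sym_def by blast
qed

lemma connected_hub:
  assumes "sym E" "\<And>u. u \<in> S \<Longrightarrow> (u, c) \<in> (induced E S)\<^sup>*"
  shows "connected_graph S (induced E S)"
  unfolding connected_graph_def
  using assms rtrancl_induced_commute rtrancl_trans by metis

lemma rtrancl_path:
  assumes "\<And>i. i < n \<Longrightarrow> (p i, p (Suc i)) \<in> R"
  shows "(p 0, p n) \<in> R\<^sup>*"
  using assms by (induction n) (auto intro: rtrancl.rtrancl_into_rtrancl)

lemma leaf_not_interior:
  assumes "sym E" "induced_path E (Suc n) p" "\<And>i. i \<le> n \<Longrightarrow> p i \<in> S"
    and "degree (induced E S) (p i) = 1" "0 < i" "i < n"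
  shows False
proof -
  have "(p (i - 1), p i) \<in> E" "(p i, p (Suc i)) \<in> E" "p (i - 1) \<noteq> p (Suc i)"
    using induced_pathD[OF assms(2), of "i - 1" i] induced_pathD[OF assms(2), of i "Suc i"]
      induced_pathD[OF assms(2), of "i - 1" "Suc i"] assms(5,6) by auto
  moreover have "p (i - 1) \<in> S" "p i \<in> S" "p (Suc i) \<in> S"
    using assms(3,5,6) by auto
  ultimately have "p (i - 1) \<in> induced E S `` {p i}" "p (Suc i) \<in> induced E S `` {p i}"
    using assms(1) unfolding induced_def by (auto dest: symD)
  moreover obtain x where "induced E S `` {p i} = {x}"
    using assms(4) unfolding degree_def by (rule card_1_singletonE)
  ultimately show False
    using \<open>p (i - 1) \<noteq> p (Suc i)\<close> by auto
qed

text \<open>A shortest path between two other vertices avoids the leaf, because its inner vertices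
  have two neighbours. This is why a minimal connected set containing the toes has no further
  leaves.\<close>

lemma connected_remove_leaf:
  assumes "sym E" "connected_graph S (induced E S)" "degree (induced E S) v = 1"
  shows "connected_graph (S - {v}) (induced E (S - {v}))"
  unfolding connected_graph_def
proof (intro ballI)
  fix u w assume uw: "u \<in> S - {v}" "w \<in> S - {v}"
  then have "(u, w) \<in> (induced E S)\<^sup>*" "u \<in> S"
    using assms(2) unfolding connected_graph_def by auto
  then obtain n p where p: "p 0 = u" "p n = w" "\<And>i. i \<le> n \<Longrightarrow> p i \<in> S" "induced_path E (Suc n) p"
    by (metis shortest_path)
  have "p i \<noteq> v" if "i \<le> n" for i
  proof
    assume "p i = v"
    moreover from this have "i \<noteq> 0 \<and> i \<noteq> n"
      using p(1,2) uw by (metis DiffD2 singletonI)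
    ultimately show False
      using leaf_not_interior[OF assms(1) p(4) p(3), of i] assms(3) that by auto
  qed
  then have "(p i, p (Suc i)) \<in> induced E (S - {v})" if "i < n" for i
    using induced_pathD[OF p(4), of i "Suc i"] p(3) that unfolding induced_def by auto
  from rtrancl_path[of n p, OF this] show "(u, w) \<in> (induced E (S - {v}))\<^sup>*"
    using p by auto
qed

context monoholed_graph
begin

abbreviation mated :: bool where
  "mated \<equiv> \<exists>k\<ge>3. \<exists>S S' T. S \<subseteq> V \<and> S' \<subseteq> V \<and> mated_spiders l k E S S' T"

text \<open>A connected set between \<open>T\<close> and \<open>A \<union> T\<close> of least
  cardinality is the spider. Each toe keeps a neighbour by connectivity and has at most one in
  \<open>A\<close>; any other leaf could be deleted.\<close>

lemma spider_exists:
  assumes A: "connected_graph A (induced E A)" "A \<subseteq> V" "A \<inter> T = {}"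
    and T: "T \<subseteq> V" "3 \<le> card T" "\<And>s t. s \<in> T \<Longrightarrow> t \<in> T \<Longrightarrow> (s, t) \<notin> E"
    and ex1: "\<And>t. t \<in> T \<Longrightarrow> \<exists>!a. a \<in> A \<and> (t, a) \<in> E"
  obtains S where "T \<subseteq> S" "S \<subseteq> A \<union> T" "spider (card T) S (induced E S) T"
proof -
  define P where "P S \<longleftrightarrow> T \<subseteq> S \<and> S \<subseteq> A \<union> T \<and> connected_graph S (induced E S)" for S
  have fin: "finite (A \<union> T)"
    using A T finite_V by (auto intro: finite_subset)
  have "T \<noteq> {}"
    using T(2) by auto
  then obtain c where c: "c \<in> A"
    using ex1 by blast
  have A_c: "(a, c) \<in> (induced E (A \<union> T))\<^sup>*" if "a \<in> A" for a
    using that c A(1) rtrancl_induced_mono[of A "A \<union> T" E] unfolding connected_graph_def by auto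
  have "(u, c) \<in> (induced E (A \<union> T))\<^sup>*" if "u \<in> A \<union> T" for u
  proof (cases "u \<in> A")
    case False
    then have "u \<in> T"
      using that by auto
    then obtain a where a: "a \<in> A" "(u, a) \<in> E"
      using ex1 by blast
    then have "(u, a) \<in> induced E (A \<union> T)"
      using that unfolding induced_def by auto
    then show ?thesis
      using A_c[OF a(1)] by (rule converse_rtrancl_into_rtrancl)
  qed (rule A_c)
  then have "P (A \<union> T)"
    unfolding P_def using connected_hub[OF sym_E, of "A \<union> T" c] by auto
  from ex_has_least_nat[of P, OF this, of card]
  obtain S where S: "P S" and least: "\<And>S'. P S' \<Longrightarrow> card S \<le> card S'"
    by auto
  then have S': "T \<subseteq> S" "S \<subseteq> A \<union> T" "connected_graph S (induced E S)" "finite S"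
    using fin unfolding P_def by (auto intro: finite_subset)
  have minimal: "\<not> connected_graph R (induced E R)" if "T \<subseteq> R" "R \<subset> S" for R
    using least[of R] that S' psubset_card_mono[of S R] unfolding P_def by force
  have toe: "degree (induced E S) t = 1" if t: "t \<in> T" for t
  proof -
    obtain a where a: "\<And>b. b \<in> A \<and> (t, b) \<in> E \<longleftrightarrow> b = a"
      using ex1[OF t] by blast
    have sub: "induced E S `` {t} \<subseteq> {a}"
      using S'(2) T(3)[OF t] a unfolding induced_def by blast
    \<comment> \<open>A second toe is needed: connectivity forces a neighbour of \<open>t\<close>
      only if there is another vertex to be reached.\<close>
    have "\<not> T \<subseteq> {t}"
      using card_mono[of "{t}" T] T(2) by auto
    then obtain s where s: "s \<in> T" "s \<noteq> t"
      by auto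
    then have "(t, s) \<in> (induced E S)\<^sup>*"
      using S' t unfolding connected_graph_def by auto
    then have "induced E S `` {t} \<noteq> {}"
      using s(2) by (auto elim: converse_rtranclE)
    with sub have "induced E S `` {t} = {a}"
      by auto
    then show ?thesis
      unfolding degree_def by simp
  qed
  have "v \<in> T" if "v \<in> S" "degree (induced E S) v = 1" for v
  proof (rule ccontr)
    assume "v \<notin> T"
    then show False
      using minimal[of "S - {v}"] connected_remove_leaf[OF sym_E S'(3) that(2)] S'(1) that(1) by auto
  qed
  with toe S'(1) have leaves: "{v \<in> S. degree (induced E S) v = 1} = T"
    by auto
  have "simple_graph S (induced E S)"
    using S'(4) sym_E unfolding simple_graph_def induced_def sym_def irrefl_def by auto
  then have "spider (card T) S (induced E S) T"
    unfolding spider_def using leaves S' T(2) minimal induced_induced[of _ S E] by (metis psubset_imp_subset)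
  with S' that show thesis by blast
qed

text \<open>Shortest paths between two toes through the two sides close up to a hole, so the distance
  condition on mates holds automatically.\<close>

lemma mated_if_separated:
  assumes A: "connected_graph A (induced E A)" "A \<subseteq> V" "A \<inter> T = {}"
    and B: "connected_graph B (induced E B)" "B \<subseteq> V" "B \<inter> T = {}"
    and AB: "A \<inter> B = {}" "\<And>a b. a \<in> A \<Longrightarrow> b \<in> B \<Longrightarrow> (a, b) \<notin> E"
    and T: "T \<subseteq> V" "3 \<le> card T" "\<And>s t. s \<in> T \<Longrightarrow> t \<in> T \<Longrightarrow> (s, t) \<notin> E"
    and ex1: "\<And>t. t \<in> T \<Longrightarrow> \<exists>!a. a \<in> A \<and> (t, a) \<in> E" "\<And>t. t \<in> T \<Longrightarrow> \<exists>!b. b \<in> B \<and> (t, b) \<in> E"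
  shows mated
proof -
  obtain S where S: "T \<subseteq> S" "S \<subseteq> A \<union> T" "spider (card T) S (induced E S) T"
    using spider_exists[OF A T ex1(1)] by blast
  obtain S' where S': "T \<subseteq> S'" "S' \<subseteq> B \<union> T" "spider (card T) S' (induced E S') T"
    using spider_exists[OF B T ex1(2)] by blast
  have toe_path: "\<exists>p. p 0 = s \<and> p (graph_dist (induced E S) s t) = t \<and>
      induced_path E (Suc (graph_dist (induced E S) s t)) p \<and>
      (\<forall>i. 0 < i \<longrightarrow> i < graph_dist (induced E S) s t \<longrightarrow> p i \<in> S - T) \<and>
      2 \<le> graph_dist (induced E S) s t"
    if sp: "spider (card T) S (induced E S) T" and st: "s \<in> T" "t \<in> T" "s \<noteq> t" for S s t
  proof -
    have "T \<subseteq> S" "(s, t) \<in> (induced E S)\<^sup>*"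
      using sp st unfolding spider_def connected_graph_def by auto
    then obtain p where p: "p 0 = s" "p (graph_dist (induced E S) s t) = t"
      "\<And>i. i \<le> graph_dist (induced E S) s t \<Longrightarrow> p i \<in> S"
      "induced_path E (Suc (graph_dist (induced E S) s t)) p"
      using shortest_path[of s t E S] st by blast
    have "graph_dist (induced E S) s t \<noteq> 0"
      using p(1,2) st by metis
    moreover have "graph_dist (induced E S) s t \<noteq> 1"
      using p(1,2) T(3)[OF st(1,2)] induced_pathD(2)[OF p(4), of 0 1] by auto
    ultimately have "2 \<le> graph_dist (induced E S) s t"
      by auto
    moreover have "p i \<notin> T" if "0 < i" "i < graph_dist (induced E S) s t" for i
      using leaf_not_interior[OF sym_E p(4) p(3)] sp that unfolding spider_def by blast
    ultimately show ?thesis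
      using p by (intro exI[of _ p]) auto
  qed
  have "graph_dist (induced E S) s t + graph_dist (induced E S') s t = l"
    if st: "s \<in> T" "t \<in> T" "s \<noteq> t" for s t
  proof -
    let ?n = "graph_dist (induced E S) s t" and ?m = "graph_dist (induced E S') s t"
    obtain p where p: "p 0 = s" "p ?n = t" "induced_path E (Suc ?n) p"
      "\<And>i. 0 < i \<Longrightarrow> i < ?n \<Longrightarrow> p i \<in> S - T" "2 \<le> ?n"
      using toe_path[OF S(3) st] by blast
    obtain q where q: "q 0 = s" "q ?m = t" "induced_path E (Suc ?m) q"
      "\<And>i. 0 < i \<Longrightarrow> i < ?m \<Longrightarrow> q i \<in> S' - T" "2 \<le> ?m"
      using toe_path[OF S'(3) st] by blast
    \<comment> \<open>The first path contributes both toes. The second is reversed, so that it leads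
      back from \<open>t\<close> to \<open>s\<close>, and contributes only its \<open>?m - 1\<close>
      inner vertices, whence the offset 1.\<close>
    have "Suc ?n + (?m - 1) = l"
    proof (rule join_paths[OF p(3)])
      show "induced_path E (?m - 1) (\<lambda>i. q (Suc ?m - 1 - (1 + i)))"
        by (rule induced_path_shift[OF induced_path_rev[OF q(3) sym_E]]) (use q(5) in auto)
      fix i j assume ij: "i < Suc ?n" "j < ?m - 1"
      define k where "k = Suc ?m - 1 - (1 + j)"
      have k: "0 < k" "k < ?m" "k = 1 \<longleftrightarrow> j = ?m - 1 - 1" "?m = Suc k \<longleftrightarrow> j = 0"
        using ij q(5) unfolding k_def by auto
      have qk: "q k \<in> B" "q k \<notin> T"
        using q(4)[OF k(1,2)] S'(2) by auto
      consider "i = 0" | "i = ?n" | "0 < i" "i < ?n"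
        using ij by linarith
      then have "p i \<noteq> q k \<and> ((p i, q k) \<in> E \<longleftrightarrow> i = Suc ?n - 1 \<and> j = 0 \<or> i = 0 \<and> j = ?m - 1 - 1)"
      proof cases
        case 1
        then show ?thesis
          using induced_pathD[OF q(3), of 0 k] k qk p(1,5) q(1) by auto
      next
        case 2
        then show ?thesis
          using induced_pathD[OF q(3), of k ?m] k qk p(2,5) q(2) adj_commute[of t "q k"] by auto
      next
        case 3
        then have "p i \<in> A"
          using p(4)[OF 3] S(2) by auto
        then show ?thesis
          using 3 AB qk(1) by auto
      qed
      then show "p i \<noteq> q (Suc ?m - 1 - (1 + j)) \<and> ((p i, q (Suc ?m - 1 - (1 + j))) \<in> E \<longleftrightarrow>
          i = Suc ?n - 1 \<and> j = 0 \<or> i = 0 \<and> j = ?m - 1 - 1)"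
        unfolding k_def .
    qed (use p(5) q(5) in auto)
    then show ?thesis
      using q(5) by auto
  qed
  moreover have "(S - T) \<inter> (S' - T) = {}" "edges_between E (S - T) (S' - T) = {}"
    using S(2) S'(2) AB adj_commute unfolding edges_between_def by blast+
  ultimately have "mated_spiders l (card T) E S S' T"
    unfolding mated_spiders_def using S(3) S'(3) by auto
  moreover have "S \<subseteq> V" "S' \<subseteq> V"
    using S S' A(2) B(2) T(1) by auto
  ultimately show ?thesis
    using T(2) by blast
qed

section \<open>Attachments to a hole\<close>

text \<open>A hole as a function on indices, so that it can be composed with a
  \<open>cycle_aut\<close> and modified by function update.\<close>

definition hole_map :: "(nat \<Rightarrow> 'a) \<Rightarrow> bool" where
  "hole_map g \<longleftrightarrow> (\<forall>i<l. \<forall>j<l. (g i = g j \<longleftrightarrow> i = j) \<and> ((g i, g j) \<in> E \<longleftrightarrow> cycle_adj l i j))"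

lemma hole_mapD:
  assumes "hole_map g" "i < l" "j < l"
  shows "g i = g j \<longleftrightarrow> i = j" "(g i, g j) \<in> E \<longleftrightarrow> cycle_adj l i j"
  using assms unfolding hole_map_def by auto

lemma hole_map_aut: "hole_map g \<Longrightarrow> cycle_aut l \<sigma> \<Longrightarrow> hole_map (\<lambda>i. g (\<sigma> i))"
  unfolding hole_map_def by (simp add: cycle_autD)

lemma cycle_adj_iff_l: "cycle_adj l i j \<longleftrightarrow> i < l \<and> j < l \<and>
    (j = Suc i \<or> i = Suc j \<or> i = 0 \<and> j = l - 1 \<or> j = 0 \<and> i = l - 1)"
  using l6 by (intro cycle_adj_iff) auto

lemma hole_map_arc:
  assumes "hole_map g" "k < l"
  shows "induced_path E k (\<lambda>i. g ((a + i) mod l))"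
  unfolding induced_path_def
proof (intro allI impI)
  fix i j assume ij: "i < k" "j < k" "i < j"
  have "0 < l" using l6 by auto
  then have "(a + i) mod l < l" "(a + j) mod l < l" by auto
  note g = hole_mapD[OF assms(1) this]
  show "g ((a + i) mod l) \<noteq> g ((a + j) mod l) \<and>
      ((g ((a + i) mod l), g ((a + j) mod l)) \<in> E \<longleftrightarrow> j = Suc i)"
    unfolding g using cycle_adj_mod[of l "a + i" "a + j"] ij assms(2) l6 by auto
qed

text \<open>Unless \<open>v\<close> sees the whole hole, some neighbour of \<open>v\<close> is
  followed by a nonneighbour; move them to 0 and 1. If \<open>b\<close> is the next neighbour after
  0, then \<open>v\<close> and the arc from 0 to \<open>b\<close> form a hole with
  \<open>b + 2\<close> vertices, so \<open>b = l - 2\<close>. The vertex at \<open>l - 1\<close> is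
  then a neighbour as well, since otherwise it would lie on a hole of length 4. So exactly three
  consecutive vertices are seen.\<close>

lemma hole_nbrs:
  assumes g: "hole_map g" and v: "\<And>k. k < l \<Longrightarrow> v \<noteq> g k"
    and ij: "i < l" "j < l" "i \<noteq> j" "\<not> cycle_adj l i j" "(v, g i) \<in> E" "(v, g j) \<in> E"
  shows "(\<forall>k<l. (v, g k) \<in> E) \<or> (\<exists>c<l. \<forall>k<l. (v, g k) \<in> E \<longleftrightarrow> k = c \<or> cycle_adj l c k)"
proof (cases "\<exists>k k'. cycle_adj l k k' \<and> (v, g k) \<in> E \<and> (v, g k') \<notin> E")
  case False
  have "(v, g ((i + d) mod l)) \<in> E" for d
  proof (induction d)
    case (Suc d)
    have "cycle_adj l ((i + d) mod l) ((i + Suc d) mod l)"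
      unfolding cycle_adj_def using l6 by (auto simp: mod_Suc_eq)
    with Suc False show ?case by blast
  qed (use ij in auto)
  from this[of "_ + l - i"] have "(v, g k) \<in> E" if "k < l" for k
    using that ij(1) by (metis add.commute le_add2 le_add_diff_inverse2 le_trans less_imp_le mod_add_self1 mod_less)
  then show ?thesis by auto
next
  case True
  then obtain k k' where k: "cycle_adj l k k'" "(v, g k) \<in> E" "(v, g k') \<notin> E"
    by auto
  obtain \<sigma> where \<sigma>: "cycle_aut l \<sigma>" "\<sigma> 0 = k" "\<sigma> 1 = k'"
    using cycle_aut_exists[of l k k'] k(1) l6 by auto
  define G where "G = (\<lambda>m. g (\<sigma> m))"
  have G: "hole_map G"
    unfolding G_def by (rule hole_map_aut[OF g \<sigma>(1)])
  have N01: "(v, G 0) \<in> E" "(v, G 1) \<notin> E"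
    unfolding G_def using k \<sigma> by auto
  have vG: "v \<noteq> G m" if "m < l" for m
    unfolding G_def using v cycle_autD(1)[OF \<sigma>(1) that] by auto
  obtain i' j' where ij': "i' < l" "\<sigma> i' = i" "j' < l" "\<sigma> j' = j"
    using cycle_autD(4)[OF \<sigma>(1)] ij by metis
  then have ij'': "i' \<noteq> j'" "\<not> cycle_adj l i' j'" "(v, G i') \<in> E" "(v, G j') \<in> E"
    using ij cycle_autD(3)[OF \<sigma>(1), of i' j'] unfolding G_def by auto
  define b where "b = (LEAST m. 0 < m \<and> (v, G m) \<in> E)"
  obtain m0 where m0: "0 < m0" "m0 < l" "(v, G m0) \<in> E"
    using ij' ij'' by (metis gr0I)
  have b: "0 < b" "(v, G b) \<in> E"
    unfolding b_def using LeastI[of "\<lambda>m. 0 < m \<and> (v, G m) \<in> E" m0] m0 by auto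
  have least: "b \<le> m" if "0 < m" "(v, G m) \<in> E" for m
    unfolding b_def using that by (intro Least_le) auto
  have "b \<noteq> 1"
    using b N01 by auto
  then have b2: "2 \<le> b" "b < l"
    using b least[of m0] m0 by auto
  \<comment> \<open>Otherwise all neighbours of \<open>v\<close> are at 0 and \<open>l - 1\<close>,
    but \<open>v\<close> has two nonadjacent ones.\<close>
  have "b \<noteq> l - 1"
  proof
    assume "b = l - 1"
    then have "i' = 0 \<or> i' = l - 1" "j' = 0 \<or> j' = l - 1"
      using least[of i'] least[of j'] ij' ij'' by fastforce+
    then show False
      using ij'' ij' by (auto simp: cycle_adj_iff_l)
  qed
  then have b3: "Suc b < l"
    using b2 by auto
  have "1 + Suc b = l"
  proof (rule join_paths[where p = "\<lambda>_. v" and q = G])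
    show "induced_path E 1 (\<lambda>_. v)"
      unfolding induced_path_def by auto
    show "induced_path E (Suc b) G"
      using hole_map_arc[OF G b3, of 0] b3 unfolding induced_path_def by auto
    show "v \<noteq> G m \<and> ((v, G m) \<in> E \<longleftrightarrow> i = 1 - 1 \<and> m = 0 \<or> i = 0 \<and> m = Suc b - 1)"
      if "i < 1" "m < Suc b" for i m :: nat
      using vG[of m] least[of m] N01 b that b3 by (cases "m = 0") auto
  qed (use b2 in auto)
  then have bl: "b = l - 2"
    by auto
  have last: "(v, G (l - 1)) \<in> E"
  proof (rule ccontr)
    assume n: "(v, G (l - 1)) \<notin> E"
    have "(G b, G (l - 1)) \<in> E" "(G (l - 1), G 0) \<in> E" "(G b, G 0) \<notin> E" "G b \<noteq> G 0"
      using hole_mapD[OF G] bl l6 by (auto simp: cycle_adj_iff_l)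
    then show False
      using no_hole4[of v "G b" "G (l - 1)" "G 0"]
        b(2) N01(1) n vG[of "l - 1"] l6 adj_commute by auto
  qed
  have nbrs: "(v, G m) \<in> E \<longleftrightarrow> m = l - 1 \<or> cycle_adj l (l - 1) m" if "m < l" for m
  proof -
    consider "m = 0" | "m = l - 1" | "m = l - 2" | "0 < m" "m < l - 2"
      using \<open>m < l\<close> by linarith
    then show ?thesis
      by cases (use last N01(1) b(2) bl least[of m] l6 in \<open>auto simp: cycle_adj_iff_l\<close>)
  qed
  have "(v, g m) \<in> E \<longleftrightarrow> m = \<sigma> (l - 1) \<or> cycle_adj l (\<sigma> (l - 1)) m" if "m < l" for m
  proof -
    obtain m' where "m' < l" "\<sigma> m' = m"
      using cycle_autD(4)[OF \<sigma>(1)] \<open>m < l\<close> by auto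
    then show ?thesis
      using nbrs[of m']
        cycle_autD(2,3)[OF \<sigma>(1)] l6 unfolding G_def by auto
  qed
  then show ?thesis
    using cycle_autD(1)[OF \<sigma>(1), of "l - 1"] l6 by auto
qed

text \<open>The hole and the path together form a theta, a pyramid or a prism: the arcs \<open>x1..y1\<close> and
  \<open>y2..x2\<close> of the hole join the attachments of \<open>p 0\<close> to those of \<open>p (m - 1)\<close>; \<open>x2 = l\<close> stands for
  the index 0.\<close>

lemma mated_if_path_at_0:
  assumes g: "hole_map g" and p: "induced_path E m p" and m: "2 \<le> m"
    and disj: "\<And>i k. i < m \<Longrightarrow> k < l \<Longrightarrow> p i \<noteq> g k"
    and att: "\<And>i i' s t. i \<le> i' \<Longrightarrow> i' < m \<Longrightarrow> s < l \<Longrightarrow> t < l \<Longrightarrow> (p i, g s) \<in> E \<Longrightarrow>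
      (p i', g t) \<in> E \<Longrightarrow> s \<noteq> t \<Longrightarrow> \<not> cycle_adj l s t \<Longrightarrow> i = 0 \<and> i' = m - 1"
    and j: "2 \<le> j" "j + 2 \<le> l" "(p (m - 1), g j) \<in> E" and p0: "(p 0, g 0) \<in> E"
  shows mated
proof -
  have l0: "0 < l" and jl: "j - 1 < l" "Suc j < l" using l6 j by auto
  define x1 where "x1 = (if (p 0, g 1) \<in> E then 1 else 0 :: nat)"
  define x2 where "x2 = (if (p 0, g (l - 1)) \<in> E then l - 1 else l)"
  define y1 where "y1 = (if (p (m - 1), g (j - 1)) \<in> E then j - 1 else j)"
  define y2 where "y2 = (if (p (m - 1), g (Suc j)) \<in> E then Suc j else j)"
  have same: "k = k' \<or> cycle_adj l k k'"
    if "(p i, g k) \<in> E" "(p i', g k') \<in> E" "i \<le> i'" "i' < m" "\<not> (i = 0 \<and> i' = m - 1)" "k < l" "k' < l"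
    for i i' k k'
    using att[of i i' k k'] that by auto
  \<comment> \<open>Seeing both hole neighbours of \<open>g 0\<close> would give the single vertex
    \<open>p 0\<close> two nonadjacent attachments, which \<open>att\<close> allows only for
    \<open>m = 1\<close>. The same holds at the other end of the path.\<close>
  have x12: "x1 = 0 \<or> x1 = 1" "x2 = l - 1 \<or> x2 = l" "\<not> (x1 = 1 \<and> x2 = l - 1)"
    using same[of 0 1 0 "l - 1"] m l6 by (auto simp: x1_def x2_def cycle_adj_iff_l)
  have y12: "y1 = j - 1 \<or> y1 = j" "y2 = j \<or> y2 = Suc j" "\<not> (y1 = j - 1 \<and> y2 = Suc j)"
    using same[of "m - 1" "j - 1" "m - 1" "Suc j"] m j l6 jl by (auto simp: y1_def y2_def cycle_adj_iff_l)
  have lin: "x1 \<le> 1" "x2 \<le> l" "l \<le> x2 + 1" "l \<le> x2 + 1 - x1" "y1 \<le> j" "j \<le> y2" "y2 \<le> y1 + 1"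
    using x12 y12 j by auto
  have X: "(p 0, g k) \<in> E \<longleftrightarrow> k = 0 \<or> k = 1 \<and> x1 = 1 \<or> k = l - 1 \<and> x2 = l - 1" if "k < l" for k
    using same[of 0 0 0 k] p0 m l6 that by (auto simp: x1_def x2_def cycle_adj_iff_l)
  have Y: "(p (m - 1), g k) \<in> E \<longleftrightarrow> k = j \<or> k = j - 1 \<and> y1 = j - 1 \<or> k = Suc j \<and> y2 = Suc j"
    if "k < l" for k
    using same[of "m - 1" j "m - 1" k] j m l6 that by (auto simp: y1_def y2_def cycle_adj_iff_l)
  \<comment> \<open>By \<open>att\<close>, an attachment of an inner vertex is equal or adjacent to
    both \<open>g 0\<close> and \<open>g j\<close>, hence is a common neighbour of the two on the
    hole.\<close>
  have int: "k = 1 \<and> j = 2 \<or> k = l - 1 \<and> j = l - 2"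
    if "(p i, g k) \<in> E" "0 < i" "i < m - 1" "k < l" for i k
  proof -
    have "i \<le> m - 1" "i < m" "m - 1 < m" "j < l"
      using that j by auto
    then have "0 = k \<or> cycle_adj l 0 k" "k = j \<or> cycle_adj l k j"
      using same[of 0 0 i k] same[of i k "m - 1" j] that p0 j(3) l0 by blast+
    then show ?thesis
      using j l6 by (auto simp: cycle_adj_iff_l)
  qed
  \<comment> \<open>\<open>left\<close> and \<open>right\<close> measure the two holes formed by the
    path and one arc. Each tolerates inner vertices of the path that see one particular vertex off
    its own arc, so that \<open>no1\<close> and \<open>no2\<close> can use it to refute exactly
    those edges.\<close>
  have left: "m + (x2 - y2 + 1) = l"
    if "y2 < x2" and no: "\<And>i k. (p i, g k) \<in> E \<Longrightarrow> 0 < i \<Longrightarrow> i < m - 1 \<Longrightarrow> k < l \<Longrightarrow> k = 1"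
  proof (rule join_paths[OF p hole_map_arc[OF g]])
    fix i d assume id: "i < m" "d < x2 - y2 + 1"
    define k where "k = y2 + d"
    have k: "k \<le> x2" "y2 \<le> k" "d = 0 \<longleftrightarrow> k = y2" "d = x2 - y2 + 1 - 1 \<longleftrightarrow> k = x2" "2 \<le> k"
      using id \<open>y2 < x2\<close> j y12 unfolding k_def by auto
    have kl: "k < l \<and> k mod l = k \<or> k = l \<and> x2 = l \<and> k mod l = 0"
      using k(1) x12(2) l0 by (cases "k = l") auto
    consider "i = 0" | "i = m - 1" | "0 < i" "i < m - 1"
      using id by linarith
    then have "(p i, g (k mod l)) \<in> E \<longleftrightarrow> i = m - 1 \<and> k = y2 \<or> i = 0 \<and> k = x2"
    proof cases
      case 1
      then show ?thesis
        using kl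
      proof (elim disjE conjE)
        assume *: "k < l" "k mod l = k"
        show ?thesis
          unfolding * 1 using X[OF *(1)] k(1,5) x12(2) m * by auto
      qed (use 1 p0 m in auto)
    next
      case 2
      then show ?thesis
        using kl
      proof (elim disjE conjE)
        assume *: "k < l" "k mod l = k"
        show ?thesis
          unfolding * 2 using Y[OF *(1)] k(2) y12(2) m j by auto
      next
        assume *: "k = l" "k mod l = 0" "x2 = l"
        show ?thesis
          unfolding *(2) 2 using Y[OF l0] *(1,3) y12(1) \<open>y2 < x2\<close> m j k(1) by auto
      qed
    next
      case 3
      then show ?thesis
        using no[of i "k mod l"] k(5) kl by fastforce
    qed
    then show "p i \<noteq> g ((y2 + d) mod l) \<and> ((p i, g ((y2 + d) mod l)) \<in> E \<longleftrightarrow>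
        i = m - 1 \<and> d = 0 \<or> i = 0 \<and> d = x2 - y2 + 1 - 1)"
      using disj[of i "k mod l"] id(1) l0 unfolding k(3,4) by (simp add: k_def)
  qed (use that m x12 y12 j in auto)
  have right: "m + (y1 - x1 + 1) = l"
    if "x1 < y1" and no: "\<And>i k. (p i, g k) \<in> E \<Longrightarrow> 0 < i \<Longrightarrow> i < m - 1 \<Longrightarrow> k < l \<Longrightarrow> k = l - 1"
  proof (rule join_paths[OF induced_path_rev[OF p sym_E] hole_map_arc[OF g]])
    fix i d assume id: "i < m" "d < y1 - x1 + 1"
    define k where "k = x1 + d"
    define i' where "i' = m - 1 - i"
    have k: "k \<le> y1" "x1 \<le> k" "d = 0 \<longleftrightarrow> k = x1" "d = y1 - x1 + 1 - 1 \<longleftrightarrow> k = y1" "k < l - 1" "k mod l = k"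
      using id \<open>x1 < y1\<close> j y12 unfolding k_def by auto
    have i': "i = m - 1 \<longleftrightarrow> i' = 0" "i = 0 \<longleftrightarrow> i' = m - 1" "i' < m"
      using id m unfolding i'_def by auto
    consider "i' = 0" | "i' = m - 1" | "0 < i'" "i' < m - 1"
      using i' by linarith
    then have "(p i', g k) \<in> E \<longleftrightarrow> i' = 0 \<and> k = x1 \<or> i' = m - 1 \<and> k = y1"
    proof cases
      case 1
      then show ?thesis
        using X[of k] k x12 m l6 by auto
    next
      case 2
      then show ?thesis
        using Y[of k] k y12 m l6 j by auto
    next
      case 3
      then show ?thesis
        using no[of i' k] k(5) by fastforce
    qed
    then show "p (m - 1 - i) \<noteq> g ((x1 + d) mod l) \<and> ((p (m - 1 - i), g ((x1 + d) mod l)) \<in> E \<longleftrightarrow>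
        i = m - 1 \<and> d = 0 \<or> i = 0 \<and> d = y1 - x1 + 1 - 1)"
      unfolding k(3,4) i' unfolding i'_def[symmetric] k_def[symmetric] k(6)
      using disj[of i' k] i' k by auto
  qed (use that m x12 y12 j in auto)
  \<comment> \<open>Such an edge forces \<open>x2 = l\<close> and \<open>y2 = 2\<close>; the hole
    through the left arc would have \<open>m + l - 1\<close> vertices. \<open>no2\<close> is the
    mirror image.\<close>
  have no1: False if "(p i, g 1) \<in> E" "0 < i" "i < m - 1" "j = 2" for i
  proof -
    have im: "i < m" "i \<le> m - 1" "m - 1 < m" "i \<noteq> m - 1"
      using that by auto
    have "x2 = l"
      using same[of 0 "l - 1" i 1] that im x12 X[of "l - 1"] l6 by (auto simp: cycle_adj_iff_l)
    moreover have "y2 = 2"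
      using same[of i 1 "m - 1" 3] that im y12 Y[of 3] l6 by (auto simp: cycle_adj_iff_l)
    ultimately show False
      using left int that l6 m by force
  qed
  have no2: False if "(p i, g (l - 1)) \<in> E" "0 < i" "i < m - 1" "j = l - 2" for i
  proof -
    have im: "i < m" "i \<le> m - 1" "m - 1 < m" "i \<noteq> m - 1"
      using that by auto
    have "x1 = 0"
      using same[of 0 1 i "l - 1"] that im x12 X[of 1] l6 by (auto simp: cycle_adj_iff_l)
    moreover have "y1 = j"
      using same[of i "l - 1" "m - 1" "j - 1"] that im y12 Y[of "j - 1"] l6 by (auto simp: cycle_adj_iff_l)
    ultimately show False
      using right int that l6 m by force
  qed
  have no: "(p i, g k) \<notin> E" if "0 < i" "i < m - 1" "k < l" for i k
    using int no1 no2 that by blast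
  have lr: "y2 < x2 \<Longrightarrow> m + (x2 - y2 + 1) = l" "x1 < y1 \<Longrightarrow> m + (y1 - x1 + 1) = l"
    using left right no by auto
  \<comment> \<open>If one arc had no edge, the other would have at least \<open>l - 1\<close>
    vertices and form with the path a hole longer than \<open>l\<close>.\<close>
  then have y2x2: "y2 < x2" and x1y1: "x1 < y1"
    using lin j m l6 by linarith+
  then have eqs: "m + (x2 - y2 + 1) = l" "m + (y1 - x1 + 1) = l"
    using lr by auto
  \<comment> \<open>Both arcs have \<open>l - m - 1\<close> edges. Together they have at least
    \<open>l - 2 \<ge> 4\<close>, because at most one edge of the hole is lost at each end of the
    path; so each arc has at least two edges.\<close>
  then have arcs: "x1 + 2 \<le> y1" "y2 + 2 \<le> x2"
    using lin l6 y2x2 x1y1 by linarith+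
  \<comment> \<open>For \<open>m = 2\<close> the arcs have \<open>l - 3\<close> edges each and at
    most \<open>l\<close> in total. This forces \<open>l = 6\<close> and a theta with ends
    \<open>g 0\<close> and \<open>g j\<close>, in which \<open>p 1\<close> has \<open>g j\<close> as
    its only neighbour on the hole.\<close>
  have m2: "x1 = 0 \<and> x2 = l \<and> y1 = j \<and> y2 = j" if "m = 2"
    using that eqs lin y2x2 x1y1 l6 j by linarith
  have gg: "(g a, g b) \<in> E \<longleftrightarrow> cycle_adj l a b" "g a = g b \<longleftrightarrow> a = b" if "a < l" "b < l" for a b
    using hole_mapD[OF g that] by auto
  have pp: "(p a, p b) \<in> E \<longleftrightarrow> b = Suc a \<or> a = Suc b" "p a = p b \<longleftrightarrow> a = b" if "a < m" "b < m" for a b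
    using induced_pathD[OF p, of a b] induced_pathD[OF p, of b a] that adj_commute[of "p a" "p b"]
    by (cases a b rule: linorder_cases; force)+
  \<comment> \<open>Deleting the toes in \<open>T\<close> splits the configuration into
    \<open>A\<close>, the side of \<open>p 0\<close>, where everything is equal or adjacent to
    \<open>g 0\<close>, and \<open>B\<close>, the side of \<open>g j\<close>. On each of the three
    paths the toe is the vertex next to \<open>A\<close>.\<close>
  define I where "I = {k. k < l \<and> (k \<le> x1 \<or> x2 \<le> k)}"
  define J where "J = {k. x1 + 2 \<le> k \<and> k + 2 \<le> x2}"
  define A where "A = insert (p 0) (g ` I)"
  define B where "B = p ` {2..<m} \<union> g ` J"
  define T where "T = {g (x1 + 1), g (x2 - 1), p 1}"
  have I: "k < l" "k = 0 \<or> k = 1 \<and> x1 = 1 \<or> k = l - 1 \<and> x2 = l - 1" if "k \<in> I" for k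
    using that x12 l6 unfolding I_def by auto
  have J: "k < l" "x1 + 2 \<le> k" "k + 2 \<le> x2" if "k \<in> J" for k
    using that x12 l6 unfolding J_def by auto
  have tl: "x1 + 1 < l" "x2 - 1 < l" "x1 + 3 \<le> x2 - 1" "l - 2 \<le> x2 - 1" "x1 + 1 \<le> 2"
    using lin arcs l6 by linarith+
  have p1: "(p 1, g k) \<in> E \<longleftrightarrow> m = 2 \<and> k = j" if "k < l" for k
    using no[of 1 k] Y[of k] m2 m j that by (cases "m = 2") auto
  \<comment> \<open>Beyond \<open>p 1\<close> only the last vertex of the path attaches to the hole,
    and \<open>y1\<close>, \<open>j\<close>, \<open>y2\<close> lie strictly between the two toes on
    the hole.\<close>
  have pm: "x1 + 2 \<le> k \<and> k + 2 \<le> x2" if "(p i, g k) \<in> E" "2 \<le> i" "i < m" "k < l" for i k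
  proof -
    have "i = m - 1"
    proof (rule ccontr)
      assume "i \<noteq> m - 1"
      then have "0 < i" "i < m - 1"
        using that by auto
      then show False
        using no that by blast
    qed
    then have "k = j \<or> k = y1 \<or> k = y2"
      using that(1) Y[OF that(4)] by auto
    moreover have "y1 \<le> j" "j \<le> y2"
      using y12(1,2) by auto
    ultimately show ?thesis
      using arcs by linarith
  qed
  have jJ: "j \<in> J"
    using arcs y12(1,2) unfolding J_def by auto
  have A_cases [consumes 1]: thesis if "a \<in> A" "a = p 0 \<Longrightarrow> thesis" "\<And>k. a = g k \<Longrightarrow> k \<in> I \<Longrightarrow> thesis" for a thesis
    using that unfolding A_def by auto
  have B_cases [consumes 1]: thesis if "b \<in> B" "\<And>k. b = g k \<Longrightarrow> k \<in> J \<Longrightarrow> thesis"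
      "\<And>i. b = p i \<Longrightarrow> 2 \<le> i \<Longrightarrow> i < m \<Longrightarrow> thesis" for b thesis
    using that unfolding B_def by auto
  have IJ: "k \<noteq> k'" "\<not> cycle_adj l k k'" if kk: "k \<in> I" "k' \<in> J" for k k'
  proof -
    have k': "2 \<le> k'" "k' + 2 \<le> l" "x1 + 2 \<le> k'" "k' + 2 \<le> x2"
      using J[OF kk(2)] x12(2) by auto
    consider "k = 0" | "k = 1" "x1 = 1" | "k = l - 1" "x2 = l - 1"
      using I(2)[OF kk(1)] by blast
    then show "k \<noteq> k'" "\<not> cycle_adj l k k'"
      by (cases; use k' l6 in \<open>simp add: cycle_adj_iff_l\<close>)+
  qed
  show ?thesis
  proof (rule mated_if_separated[of A T B])
    show "connected_graph A (induced E A)"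
    proof (rule connected_hub[OF sym_E, of _ "g 0"])
      fix u assume u: "u \<in> A"
      have 0: "0 \<in> I" unfolding I_def using l6 by auto
      have "u = g 0 \<or> (u, g 0) \<in> E"
        using u
      proof (cases rule: A_cases)
        case (2 k)
        have "k = 0 \<or> cycle_adj l k 0"
          using I(2)[OF 2(2)] l6 by (auto simp: cycle_adj_iff_l)
        then show ?thesis
          using gg(1)[OF I(1)[OF 2(2)] l0] 2(1) by auto
      qed (use p0 in auto)
      then show "(u, g 0) \<in> (induced E A)\<^sup>*"
        using u 0 unfolding induced_def A_def by blast
    qed
    have up: "(g (x1 + 2 + d), g (x1 + 2)) \<in> (induced E B)\<^sup>*" if "x1 + 2 + d \<in> J" for d
      using that
    proof (induction d)
      case (Suc d)
      then have d: "x1 + 2 + d \<in> J" "x1 + 2 + Suc d \<in> J" 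
        unfolding J_def by auto
      then have "(g (x1 + 2 + Suc d), g (x1 + 2 + d)) \<in> E"
        using gg(1)[OF J(1)[OF d(2)] J(1)[OF d(1)]] J(1)[OF d(2)] by (simp add: cycle_adj_iff_l)
      then have "(g (x1 + 2 + Suc d), g (x1 + 2 + d)) \<in> induced E B"
        using d unfolding B_def induced_def by blast
      then show ?case
        using Suc.IH[OF d(1)] by (rule converse_rtrancl_into_rtrancl)
    qed simp
    have gJ: "(g k, g (x1 + 2)) \<in> (induced E B)\<^sup>*" if "k \<in> J" for k
      using up that le_Suc_ex[OF J(2)[OF that]] by metis
    have pB: "(p (m - 1 - d), g (x1 + 2)) \<in> (induced E B)\<^sup>*" if "2 + d < m" for d
      using that
    proof (induction d)
      case 0
      have "(p (m - 1), g j) \<in> induced E B"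
        using 0 j(3) jJ unfolding B_def induced_def by auto
      then show ?case
        using gJ[OF jJ] by (auto intro: converse_rtrancl_into_rtrancl)
    next
      case (Suc d)
      have "(p (m - 1 - Suc d), p (m - 1 - d)) \<in> induced E B"
        using Suc.prems pp(1)[of "m - 1 - Suc d" "m - 1 - d"] unfolding B_def induced_def by auto
      then show ?case
        using Suc by (auto intro: converse_rtrancl_into_rtrancl)
    qed
    show "connected_graph B (induced E B)"
    proof (rule connected_hub[OF sym_E, of _ "g (x1 + 2)"])
      fix u assume "u \<in> B"
      then show "(u, g (x1 + 2)) \<in> (induced E B)\<^sup>*"
      proof (cases rule: B_cases)
        case (2 i)
        then show ?thesis
          using pB[of "m - 1 - i"] by (simp add: Suc_diff_Suc)
      qed (use gJ in auto)
    qed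
    have gV: "g k \<in> V" if "k < l" for k
      using gg(1)[OF that, of "Suc k mod l"] that l0 adj_in_V(1) unfolding cycle_adj_def by auto
    have pV: "p i \<in> V" if "i < m" for i
    proof (cases i)
      case 0
      then show ?thesis
        using pp(1)[of 0 1] m adj_in_V(1) by auto
    next
      case (Suc d)
      then show ?thesis
        using pp(1)[of d i] that adj_in_V(2) by auto
    qed
    show "A \<subseteq> V" "B \<subseteq> V" "T \<subseteq> V"
      using gV pV I(1) J(1) tl(1,2) m unfolding A_def B_def T_def by auto
    have "a \<notin> T" if "a \<in> A" for a
      using that
    proof (cases rule: A_cases)
      case 1
      then show ?thesis
        using disj[of 0] pp(2)[of 0 1] tl m unfolding T_def by auto
    next
      case (2 k)
      then show ?thesis
        using disj[of 1 k] gg(2)[of k] I[of k] tl m x12 l6 unfolding T_def by auto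
    qed
    then show "A \<inter> T = {}"
      by auto
    have "b \<notin> T" if "b \<in> B" for b
      using that
    proof (cases rule: B_cases)
      case (1 k)
      then show ?thesis
        using disj[of 1 k] gg(2)[of k] J[of k] tl m unfolding T_def by auto
    next
      case (2 i)
      then show ?thesis
        using disj[of i] pp(2)[of i 1] tl m unfolding T_def by auto
    qed
    then show "B \<inter> T = {}"
      by auto
    have "a \<noteq> b \<and> (a, b) \<notin> E" if a: "a \<in> A" and b: "b \<in> B" for a b
      using a
    proof (cases rule: A_cases)
      case a: 1
      show ?thesis
        using b
      proof (cases rule: B_cases)
        case (1 k)
        then show ?thesis
          using a disj[of 0 k] X[OF J(1)[OF 1(2)]] J[OF 1(2)] m x12 l6 by auto
      next
        case (2 i)
        then show ?thesis
          using a pp[of 0 i] m by auto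
      qed
    next
      case a: (2 k)
      show ?thesis
        using b
      proof (cases rule: B_cases)
        case (1 k')
        then show ?thesis
          using a gg[OF I(1)[OF a(2)] J(1)[OF 1(2)]] IJ[OF a(2) 1(2)] by auto
      next
        case (2 i)
        then show ?thesis
          using a disj[of i k] pm[of i k] I[OF a(2)] adj_commute[of "g k" "p i"] x12 by auto
      qed
    qed
    then show "A \<inter> B = {}" "\<And>a b. a \<in> A \<Longrightarrow> b \<in> B \<Longrightarrow> (a, b) \<notin> E"
      by auto
    have "g (x1 + 1) \<noteq> g (x2 - 1)" "p 1 \<noteq> g (x1 + 1)" "p 1 \<noteq> g (x2 - 1)"
      using gg tl disj m by auto
    then show "3 \<le> card T"
      unfolding T_def by auto
    have "(g (x1 + 1), g (x2 - 1)) \<notin> E"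
      using gg tl x12 by (auto simp: cycle_adj_iff_l)
    moreover have "(p 1, g (x1 + 1)) \<notin> E" "(p 1, g (x2 - 1)) \<notin> E"
      using p1 tl m2 j l6 by auto
    ultimately show "(s, t) \<notin> E" if "s \<in> T" "t \<in> T" for s t
      using that adj_commute unfolding T_def by auto
    show "\<exists>!a. a \<in> A \<and> (t, a) \<in> E" if "t \<in> T" for t
    proof -
      consider "t = g (x1 + 1)" | "t = g (x2 - 1)" | "t = p 1"
        using \<open>t \<in> T\<close> unfolding T_def by auto
      then show ?thesis
      proof cases
        case 1
        show ?thesis
        proof (rule ex1I[of _ "g x1"])
          show "g x1 \<in> A \<and> (t, g x1) \<in> E"
            using 1 gg tl unfolding A_def I_def by (auto simp: cycle_adj_iff_l)
          show "a = g x1" if "a \<in> A \<and> (t, a) \<in> E" for a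
            using that[THEN conjunct1]
          proof (cases rule: A_cases)
            case a: 1
            then show ?thesis
              using that 1 X[OF tl(1)] adj_commute[of "p 0" "g (x1 + 1)"] x12 l6 by auto
          next
            case a: (2 k)
            then have "cycle_adj l (x1 + 1) k"
              using that 1 gg(1)[OF tl(1) I(1)] by auto
            then show ?thesis
              using a I(2)[OF a(2)] x12 l6 by (auto simp: cycle_adj_iff_l)
          qed
        qed
      next
        case 2
        show ?thesis
        proof (rule ex1I[of _ "g (x2 mod l)"])
          show "g (x2 mod l) \<in> A \<and> (t, g (x2 mod l)) \<in> E"
            using 2 gg tl x12 l6 unfolding A_def I_def by (auto simp: cycle_adj_iff_l)
          show "a = g (x2 mod l)" if "a \<in> A \<and> (t, a) \<in> E" for a
            using that[THEN conjunct1]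
          proof (cases rule: A_cases)
            case a: 1
            then show ?thesis
              using that 2 X[OF tl(2)] adj_commute[of "p 0" "g (x2 - 1)"] x12 l6 by auto
          next
            case a: (2 k)
            then have "cycle_adj l (x2 - 1) k"
              using that 2 gg(1)[OF tl(2) I(1)] by auto
            then show ?thesis
              using a I(2)[OF a(2)] x12 l6 by (auto simp: cycle_adj_iff_l)
          qed
        qed
      next
        case 3
        show ?thesis
        proof (rule ex1I[of _ "p 0"])
          show "p 0 \<in> A \<and> (t, p 0) \<in> E"
            using 3 pp m unfolding A_def by auto
          show "a = p 0" if "a \<in> A \<and> (t, a) \<in> E" for a
            using that[THEN conjunct1]
          proof (cases rule: A_cases)
            case a: (2 k)
            then show ?thesis
              using that 3 p1[OF I(1)[OF a(2)]] I(2)[OF a(2)] j l6 by auto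
          qed
        qed
      qed
    qed
    show "\<exists>!b. b \<in> B \<and> (t, b) \<in> E" if "t \<in> T" for t
    proof -
      consider "t = g (x1 + 1)" | "t = g (x2 - 1)" | "t = p 1"
        using \<open>t \<in> T\<close> unfolding T_def by auto
      then show ?thesis
      proof cases
        case 1
        show ?thesis
        proof (rule ex1I[of _ "g (x1 + 2)"])
          show "g (x1 + 2) \<in> B \<and> (t, g (x1 + 2)) \<in> E"
            using 1 gg tl unfolding B_def J_def by (auto simp: cycle_adj_iff_l)
          show "b = g (x1 + 2)" if b: "b \<in> B \<and> (t, b) \<in> E" for b
            using b[THEN conjunct1]
          proof (cases rule: B_cases)
            case c: (1 k)
            then have "cycle_adj l (x1 + 1) k"
              using b 1 gg(1)[OF tl(1) J(1)] by auto
            then show ?thesis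
              using c J[OF c(2)] x12 l6 by (auto simp: cycle_adj_iff_l)
          next
            case c: (2 i)
            then show ?thesis
              using b 1 pm[OF _ c(2,3) tl(1)] adj_commute[of "p i" "g (x1 + 1)"] by auto
          qed
        qed
      next
        case 2
        show ?thesis
        proof (rule ex1I[of _ "g (x2 - 2)"])
          show "g (x2 - 2) \<in> B \<and> (t, g (x2 - 2)) \<in> E"
            using 2 gg tl x12 l6 unfolding B_def J_def by (auto simp: cycle_adj_iff_l)
          show "b = g (x2 - 2)" if b: "b \<in> B \<and> (t, b) \<in> E" for b
            using b[THEN conjunct1]
          proof (cases rule: B_cases)
            case c: (1 k)
            then have "cycle_adj l (x2 - 1) k"
              using b 2 gg(1)[OF tl(2) J(1)] by auto
            then have "k = x2 - 2"
              using J[OF c(2)] l6 by (auto simp: cycle_adj_iff_l)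
            then show ?thesis
              using c by simp
          next
            case c: (2 i)
            then show ?thesis
              using b 2 pm[OF _ c(2,3) tl(2)] adj_commute[of "p i" "g (x2 - 1)"] by auto
          qed
        qed
      next
        case 3
        \<comment> \<open>For \<open>m = 2\<close> the toe \<open>p 1\<close> is itself the end of
          the path, so its neighbour in \<open>B\<close> is \<open>g j\<close>; otherwise it is
          \<open>p 2\<close>.\<close>
        show ?thesis
        proof (cases "m = 2")
          case True
          then show ?thesis
            using 3 p1 jJ J unfolding B_def by (intro ex1I[of _ "g j"]) auto
        next
          case False
          then show ?thesis
            using 3 p1 J pp m unfolding B_def by (intro ex1I[of _ "p 2"]) auto
        qed
      qed
    qed
  qed
qed

text \<open>Hypothesis \<open>att\<close> is what a path of minimal length provides: nonadjacent
  attachments occur only between its two ends. The first attachment is rotated to index 0.\<close>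

lemma mated_if_path:
  assumes g: "hole_map g" and p: "induced_path E m p" and m: "2 \<le> m"
    and disj: "\<And>i k. i < m \<Longrightarrow> k < l \<Longrightarrow> p i \<noteq> g k"
    and att: "\<And>i i' s t. i \<le> i' \<Longrightarrow> i' < m \<Longrightarrow> s < l \<Longrightarrow> t < l \<Longrightarrow> (p i, g s) \<in> E \<Longrightarrow>
      (p i', g t) \<in> E \<Longrightarrow> s \<noteq> t \<Longrightarrow> \<not> cycle_adj l s t \<Longrightarrow> i = 0 \<and> i' = m - 1"
    and ends: "s < l" "t < l" "s \<noteq> t" "\<not> cycle_adj l s t" "(p 0, g s) \<in> E" "(p (m - 1), g t) \<in> E"
  shows mated
proof -
  have "cycle_adj l s (Suc s mod l)" "3 \<le> l"
    using ends l6 unfolding cycle_adj_def by auto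
  then obtain \<sigma> where \<sigma>: "cycle_aut l \<sigma>" "\<sigma> 0 = s"
    by (metis cycle_aut_exists)
  obtain j where j: "j < l" "\<sigma> j = t"
    using cycle_autD(4)[OF \<sigma>(1) ends(2)] by auto
  have "j \<noteq> 0"
    using j \<sigma> ends by metis
  moreover have "\<not> cycle_adj l 0 j"
    using j ends \<sigma> cycle_autD(3)[OF \<sigma>(1), of 0 j] by auto
  ultimately have j2: "2 \<le> j" "j + 2 \<le> l"
    using j(1) l6 by (auto simp: cycle_adj_iff_l)
  show ?thesis
  proof (rule mated_if_path_at_0[OF hole_map_aut[OF g \<sigma>(1)] p m _ _ j2])
    fix i i' s t assume "i \<le> i'" "i' < m" "s < l" "t < l" "(p i, g (\<sigma> s)) \<in> E"
      "(p i', g (\<sigma> t)) \<in> E" "s \<noteq> t" "\<not> cycle_adj l s t"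
    then show "i = 0 \<and> i' = m - 1"
      using att[of i i' "\<sigma> s" "\<sigma> t"] cycle_autD[OF \<sigma>(1)] by auto
  qed (use disj ends \<sigma> j cycle_autD(1)[OF \<sigma>(1)] in auto)
qed

section \<open>Rings of cliques\<close>

text \<open>Asks only for one neighbour in each adjacent clique in place of half-graphs,
  connectedness and compatibility, all of which follow in \<open>ring_inflated\<close>. So inserting
  a vertex requires few checks.\<close>

definition hole_ring :: "(nat \<Rightarrow> 'a set) \<Rightarrow> bool" where
  "hole_ring K \<longleftrightarrow>
     (\<forall>i<l. K i \<subseteq> V \<and> K i \<noteq> {} \<and> clique E (K i)) \<and>
     (\<forall>i<l. \<forall>j<l. i \<noteq> j \<longrightarrow> K i \<inter> K j = {}) \<and>
     (\<forall>i<l. \<forall>j<l. \<forall>u\<in>K i. \<forall>v\<in>K j. (u, v) \<in> E \<longrightarrow> i = j \<or> cycle_adj l i j) \<and>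
     (\<forall>i<l. \<forall>j<l. cycle_adj l i j \<longrightarrow> (\<forall>u\<in>K i. \<exists>v\<in>K j. (u, v) \<in> E))"

lemma hole_ringD:
  assumes "hole_ring K"
  shows "i < l \<Longrightarrow> K i \<subseteq> V"
    and "i < l \<Longrightarrow> K i \<noteq> {}"
    and "i < l \<Longrightarrow> u \<in> K i \<Longrightarrow> v \<in> K i \<Longrightarrow> u \<noteq> v \<Longrightarrow> (u, v) \<in> E"
    and "i < l \<Longrightarrow> j < l \<Longrightarrow> u \<in> K i \<Longrightarrow> u \<in> K j \<Longrightarrow> i = j"
    and "i < l \<Longrightarrow> j < l \<Longrightarrow> u \<in> K i \<Longrightarrow> v \<in> K j \<Longrightarrow> (u, v) \<in> E \<Longrightarrow> i = j \<or> cycle_adj l i j"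
    and "cycle_adj l i j \<Longrightarrow> u \<in> K i \<Longrightarrow> \<exists>v\<in>K j. (u, v) \<in> E"
proof -
  note r = assms[unfolded hole_ring_def]
  show "i < l \<Longrightarrow> K i \<subseteq> V" "i < l \<Longrightarrow> K i \<noteq> {}"
    using r by blast+
  show "i < l \<Longrightarrow> u \<in> K i \<Longrightarrow> v \<in> K i \<Longrightarrow> u \<noteq> v \<Longrightarrow> (u, v) \<in> E"
    using r unfolding clique_def by blast
  show "i < l \<Longrightarrow> j < l \<Longrightarrow> u \<in> K i \<Longrightarrow> u \<in> K j \<Longrightarrow> i = j"
    using r by blast
  show "i < l \<Longrightarrow> j < l \<Longrightarrow> u \<in> K i \<Longrightarrow> v \<in> K j \<Longrightarrow> (u, v) \<in> E \<Longrightarrow> i = j \<or> cycle_adj l i j"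
    using r by blast
  show "cycle_adj l i j \<Longrightarrow> u \<in> K i \<Longrightarrow> \<exists>v\<in>K j. (u, v) \<in> E"
    using r unfolding cycle_adj_def by blast
qed

lemma hole_ring_aut:
  assumes "hole_ring K" "cycle_aut l \<sigma>"
  shows "hole_ring (\<lambda>i. K (\<sigma> i))" "(\<Union>i<l. K (\<sigma> i)) = (\<Union>i<l. K i)"
proof -
  note \<sigma> = cycle_autD[OF assms(2)]
  note r = assms(1)[unfolded hole_ring_def]
  show "hole_ring (\<lambda>i. K (\<sigma> i))"
    unfolding hole_ring_def
  proof (intro conjI allI impI ballI)
    fix i j assume ij: "i < l" "j < l"
    show "K (\<sigma> i) \<subseteq> V" "K (\<sigma> i) \<noteq> {}" "clique E (K (\<sigma> i))"
      using r \<sigma>(1)[OF ij(1)] by blast+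
    show "K (\<sigma> i) \<inter> K (\<sigma> j) = {}" if "i \<noteq> j"
      using r \<sigma>(1)[OF ij(1)] \<sigma>(1)[OF ij(2)] \<sigma>(2)[OF ij] that by blast
    show "i = j \<or> cycle_adj l i j" if "u \<in> K (\<sigma> i)" "v \<in> K (\<sigma> j)" "(u, v) \<in> E" for u v
      using r \<sigma>(1)[OF ij(1)] \<sigma>(1)[OF ij(2)] \<sigma>(2,3)[OF ij] that by blast
    show "\<exists>v\<in>K (\<sigma> j). (u, v) \<in> E" if "cycle_adj l i j" "u \<in> K (\<sigma> i)" for u
      using r \<sigma>(1)[OF ij(1)] \<sigma>(1)[OF ij(2)] \<sigma>(3)[OF ij] that by blast
  qed
  have "(\<Union>i<l. K (\<sigma> i)) = \<Union> (K ` (\<sigma> ` {..<l}))"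
    by auto
  then show "(\<Union>i<l. K (\<sigma> i)) = (\<Union>i<l. K i)"
    unfolding \<sigma>(5) .
qed

section \<open>Nested neighbourhoods between consecutive cliques\<close>

lemma ring_nested:
  assumes K: "hole_ring K" and ij: "cycle_adj l i j"
    and a: "a \<in> K i" "a' \<in> K i" and b: "b \<in> K j" "b' \<in> K j"
    and e: "(a, b) \<in> E" "(a', b) \<notin> E" "(a', b') \<in> E" "(a, b') \<notin> E"
  shows False
proof -
  have l: "i < l" "j < l" "i \<noteq> j"
    using ij l6 by (auto simp: cycle_adj_iff_l)
  have "(b, b') \<in> E" "(a', a) \<in> E"
    using hole_ringD(3)[OF K l(2) b] hole_ringD(3)[OF K l(1) a(2,1)] e by auto
  moreover have "a \<noteq> b'" "b \<noteq> a'"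
    using hole_ringD(4)[OF K l(1,2)] l(3) a b by auto
  ultimately show False
    using no_hole4[of a b b' a'] e adj_commute by blast
qed

text \<open>The edge between \<open>a\<close> and \<open>a'\<close> closes a shortest path from
  \<open>c\<close> to \<open>b\<close> through the other cliques to a hole. That path advances by at
  most one clique per step, so it has at least \<open>l - 1\<close> vertices, and the hole has more
  than \<open>l\<close>.\<close>

lemma ring_cross_at_0:
  assumes K: "hole_ring K" and a: "a \<in> K 0" "a' \<in> K 0" and b: "b \<in> K (l - 1)" and c: "c \<in> K 1"
    and e: "(a, b) \<in> E" "(a', b) \<notin> E" "(a', c) \<in> E" "(a, c) \<notin> E"
  shows False
proof -
  define S where "S = {b, c} \<union> (\<Union>i\<in>{2..l-2}. K i)"
  have l: "0 < l" "1 < l" "l - 1 < l"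
    using l6 by auto
  have reach: "(c, u) \<in> (induced E S)\<^sup>*" if "2 + d \<le> l - 2" "u \<in> K (2 + d)" for d u
    using that
  proof (induction d arbitrary: u)
    case 0
    have "cycle_adj l 1 2"
      using l6 by (auto simp: cycle_adj_iff_l)
    then obtain w where w: "w \<in> K 2" "(c, w) \<in> E"
      using hole_ringD(6)[OF K _ c] by blast
    have "K 2 \<subseteq> S"
      using l6 unfolding S_def by auto
    then have "(c, w) \<in> induced E S" "w = u \<or> (w, u) \<in> induced E S"
      using w 0 hole_ringD(3)[OF K _ w(1), of u] l6 unfolding induced_def S_def by auto
    then show ?case
      by (auto intro: rtrancl_into_rtrancl)
  next
    case (Suc d)
    have "cycle_adj l (2 + Suc d) (2 + d)"
      using Suc.prems l6 by (auto simp: cycle_adj_iff_l)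
    then obtain w where w: "w \<in> K (2 + d)" "(u, w) \<in> E"
      using hole_ringD(6)[OF K _ Suc.prems(2)] by blast
    have "K (2 + d) \<subseteq> S" "K (2 + Suc d) \<subseteq> S"
      using Suc.prems(1) unfolding S_def by auto
    then have "(w, u) \<in> induced E S"
      using w Suc.prems adj_commute unfolding induced_def by blast
    then show ?case
      using Suc.IH[OF _ w(1)] Suc.prems(1) by (auto intro: rtrancl_into_rtrancl)
  qed
  have "cycle_adj l (l - 1) (l - 2)"
    using l6 by (auto simp: cycle_adj_iff_l)
  then obtain w where w: "w \<in> K (l - 2)" "(b, w) \<in> E"
    using hole_ringD(6)[OF K _ b] by blast
  moreover have "K (l - 2) \<subseteq> S" "b \<in> S"
    using l6 unfolding S_def by auto
  ultimately have "(w, b) \<in> induced E S"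
    using adj_commute unfolding induced_def by blast
  moreover have "(c, w) \<in> (induced E S)\<^sup>*"
  proof -
    have "l - 2 = 2 + (l - 4)"
      using l6 by auto
    then show ?thesis
      using reach[of "l - 4" w] w(1) by auto
  qed
  ultimately have "(c, b) \<in> (induced E S)\<^sup>*"
    by (rule rtrancl_into_rtrancl[rotated])
  moreover have "c \<in> S"
    unfolding S_def by auto
  ultimately obtain n p where p: "p 0 = c" "p n = b" "\<And>i. i \<le> n \<Longrightarrow> p i \<in> S" "induced_path E (Suc n) p"
    by (metis shortest_path)
  \<comment> \<open>Without \<open>K 0\<close> the cliques are arranged in a line, so after
    \<open>i\<close> steps the path has come no further than clique \<open>1 + i\<close>.\<close>
  have "\<exists>k. 1 \<le> k \<and> k < l \<and> k \<le> 1 + i \<and> p i \<in> K k" if "i \<le> n" for i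
    using that
  proof (induction i)
    case 0
    then show ?case
      using p(1) c l by (intro exI[of _ 1]) auto
  next
    case (Suc i)
    then obtain k where k: "1 \<le> k" "k < l" "k \<le> 1 + i" "p i \<in> K k"
      by auto
    from p(3)[OF Suc.prems] consider "p (Suc i) = b" | "p (Suc i) = c"
      | j where "2 \<le> j" "j \<le> l - 2" "p (Suc i) \<in> K j"
      unfolding S_def by auto
    then obtain k' where k': "1 \<le> k'" "k' < l" "p (Suc i) \<in> K k'"
    proof cases
      case 1
      then show thesis using that[of "l - 1"] b l by auto
    next
      case 2
      then show thesis using that[of 1] c l by auto
    next
      case (3 j)
      then show thesis using that[of j] l6 by auto
    qed
    have "(p i, p (Suc i)) \<in> E"
      using induced_pathD(2)[OF p(4), of i "Suc i"] Suc.prems by auto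
    then have "k' \<le> Suc k"
      using hole_ringD(5)[OF K k(2) k'(2) k(4) k'(3)] k(1) k'(1) by (auto simp: cycle_adj_iff_l)
    then show ?case
      using k' k(3) by (intro exI[of _ k']) auto
  qed
  from this[of n] obtain k where "k < l" "k \<le> 1 + n" "b \<in> K k"
    using p(2) by auto
  then have n: "l \<le> n + 2"
    using hole_ringD(4)[OF K _ l(3) _ b] by fastforce
  have inj: "p j = p j' \<longleftrightarrow> j = j'" if "j \<le> n" "j' \<le> n" for j j'
    using induced_pathD(1)[OF p(4), of j j'] induced_pathD(1)[OF p(4), of j' j] that
    by (cases j j' rule: linorder_cases) auto
  have "a \<noteq> a'"
    using e by auto
  have ends: "x \<noteq> p j \<and> ((x, p j) \<in> E \<longleftrightarrow> (j = 0 \<and> (x, c) \<in> E) \<or> (j = n \<and> (x, b) \<in> E))"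
    if x: "x \<in> K 0" and j: "j \<le> n" for x j
  proof -
    from p(3)[OF j] consider "p j = c" | "p j = b" | k where "2 \<le> k" "k \<le> l - 2" "p j \<in> K k"
      unfolding S_def by auto
    then show ?thesis
    proof cases
      case 1
      moreover have "x \<noteq> c"
        using hole_ringD(4)[OF K l(1,2) x] c by auto
      ultimately show ?thesis
        using inj[of j 0] inj[of j n] p(1,2) j by auto
    next
      case 2
      moreover have "x \<noteq> b"
        using hole_ringD(4)[OF K l(1,3) x] b l by auto
      ultimately show ?thesis
        using inj[of j 0] inj[of j n] p(1,2) j by auto
    next
      case 3
      then have k: "k < l" "k \<noteq> 0" "k \<noteq> 1" "k \<noteq> l - 1" "\<not> cycle_adj l 0 k"
        using l6 by (auto simp: cycle_adj_iff_l)
      then have "x \<noteq> p j" "(x, p j) \<notin> E"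
        using hole_ringD(4)[OF K l(1) k(1) x] hole_ringD(5)[OF K l(1) k(1) x 3(3)] 3(3) by auto
      moreover have "p j \<noteq> c" "p j \<noteq> b"
        using hole_ringD(4)[OF K k(1) _ 3(3)] b c k l by auto
      ultimately show ?thesis
        using p(1,2) by auto
    qed
  qed
  have "2 + Suc n = l"
  proof (rule join_paths[where p = "\<lambda>i. if i = 0 then a else a'", OF _ p(4)])
    show "induced_path E 2 (\<lambda>i. if i = 0 then a else a')"
      using hole_ringD(3)[OF K l(1) a] \<open>a \<noteq> a'\<close> unfolding induced_path_def by auto
    show "(if i = 0 then a else a') \<noteq> p j \<and> (((if i = 0 then a else a'), p j) \<in> E \<longleftrightarrow>
        i = 2 - 1 \<and> j = 0 \<or> i = 0 \<and> j = Suc n - 1)" if "i < 2" "j < Suc n" for i j :: nat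
      using ends[of a j] ends[of a' j] a e that n l6 by auto
  qed (use n l6 in auto)
  with n show False by auto
qed

lemma ring_cross:
  assumes K: "hole_ring K" and adj: "cycle_adj l i x" "cycle_adj l i y" "x \<noteq> y"
    and a: "a \<in> K i" "a' \<in> K i" and b: "b \<in> K x" and c: "c \<in> K y"
    and e: "(a, b) \<in> E" "(a', b) \<notin> E" "(a', c) \<in> E" "(a, c) \<notin> E"
  shows False
proof -
  obtain \<sigma> where \<sigma>: "cycle_aut l \<sigma>" "\<sigma> 0 = i" "\<sigma> 1 = y"
    using cycle_aut_exists[OF _ adj(2)] l6 by auto
  have "x < l"
    using adj by (auto simp: cycle_adj_iff_l)
  then obtain x' where x': "x' < l" "\<sigma> x' = x"
    using cycle_autD(4)[OF \<sigma>(1)] by auto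
  then have "cycle_adj l 0 x'" "x' \<noteq> 1"
    using cycle_autD(3)[OF \<sigma>(1), of 0 x'] \<sigma> adj l6 by auto
  then have "x' = l - 1"
    using l6 by (auto simp: cycle_adj_iff_l)
  then show False
    using ring_cross_at_0[OF hole_ring_aut(1)[OF K \<sigma>(1)], of a a' b c] \<sigma> x' a b c e by auto
qed

section \<open>Vertices complete to both adjacent cliques\<close>

definition core :: "(nat \<Rightarrow> 'a set) \<Rightarrow> (nat \<Rightarrow> 'a) \<Rightarrow> bool" where
  "core K h \<longleftrightarrow> (\<forall>i<l. h i \<in> K i) \<and> (\<forall>i j. cycle_adj l i j \<longrightarrow> (\<forall>u\<in>K j. (h i, u) \<in> E))"

lemma coreD:
  assumes "core K h"
  shows "i < l \<Longrightarrow> h i \<in> K i" "cycle_adj l i j \<Longrightarrow> u \<in> K j \<Longrightarrow> (h i, u) \<in> E"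
    "cycle_adj l i j \<Longrightarrow> u \<in> K j \<Longrightarrow> (u, h i) \<in> E"
  using assms adj_commute unfolding core_def by auto

lemma core_aut: "core K h \<Longrightarrow> cycle_aut l \<sigma> \<Longrightarrow> core (\<lambda>i. K (\<sigma> i)) (\<lambda>i. h (\<sigma> i))"
  unfolding core_def using cycle_autD(1,3)[of l \<sigma>]
  by (metis cycle_adj_iff_l)

text \<open>By \<open>ring_nested\<close> and \<open>ring_cross\<close> the neighbourhoods
  \<open>N a\<close> of the vertices of one clique form a chain. The largest one contains everything
  in the adjacent cliques, because every vertex there has some neighbour in
  \<open>K i\<close>.\<close>

lemma core_exists:
  assumes K: "hole_ring K"
  obtains h where "core K h"
proof -
  have "\<exists>a. a \<in> K i \<and> (\<forall>j. cycle_adj l i j \<longrightarrow> (\<forall>u\<in>K j. (a, u) \<in> E))" if i: "i < l" for i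
  proof -
    define N where "N a = {u. \<exists>j. cycle_adj l i j \<and> u \<in> K j \<and> (a, u) \<in> E}" for a
    have N: "finite (N a)" "card (N a) < Suc (card V)" for a
    proof -
      have "N a \<subseteq> V"
        unfolding N_def using adj_in_V by auto
      then show "finite (N a)" "card (N a) < Suc (card V)"
        using finite_V finite_subset card_mono[of V "N a"] by auto
    qed
    obtain a0 where "a0 \<in> K i"
      using hole_ringD(2)[OF K i] by auto
    from ex_has_greatest_nat[of "\<lambda>a. a \<in> K i", OF this, of "\<lambda>a. card (N a)" "Suc (card V)"] N(2)
    obtain h where h: "h \<in> K i" and max: "\<And>a. a \<in> K i \<Longrightarrow> card (N a) \<le> card (N h)"
      by (metis less_imp_le)
    have "(h, u) \<in> E" if j: "cycle_adj l i j" and u: "u \<in> K j" for j u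
    proof (rule ccontr)
      assume n: "(h, u) \<notin> E"
      obtain a where a: "a \<in> K i" "(a, u) \<in> E"
        using hole_ringD(6)[OF K _ u] j cycle_adj_sym adj_commute by blast
      have "u \<in> N a" "u \<notin> N h"
        using a n u j unfolding N_def by auto
      then have "\<not> N h \<subseteq> N a"
        using psubset_card_mono[OF N(1)[of a], of "N h"] max[OF a(1)] by auto
      then obtain u' j' where u': "cycle_adj l i j'" "u' \<in> K j'" "(h, u') \<in> E" "(a, u') \<notin> E"
        unfolding N_def by blast
      show False
      proof (cases "j = j'")
        case True
        then show False
          using ring_nested[OF K j a(1) h u] u' a(2) n by auto
      next
        case False
        then show False
          using ring_cross[OF K j u'(1) False a(1) h u u'(2)] u' a(2) n by auto
      qed
    qed
    with h show ?thesis by blast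
  qed
  then obtain h where h: "\<And>i. i < l \<Longrightarrow> h i \<in> K i \<and> (\<forall>j. cycle_adj l i j \<longrightarrow> (\<forall>u\<in>K j. (h i, u) \<in> E))"
    by metis
  then have "core K h"
    unfolding core_def cycle_adj_iff_l by blast
  then show thesis
    using that by blast
qed

text \<open>Half-graphs come from \<open>ring_nested\<close>, compatibility from
  \<open>ring_cross\<close>, and connectedness from the core: \<open>h i\<close> sees all of
  \<open>K j\<close>, and \<open>h j\<close> sees all of \<open>K i\<close>.\<close>

lemma ring_inflated:
  assumes K: "hole_ring K" and V: "V = (\<Union>i<l. K i)"
  shows "inflated_hole l V E"
proof -
  obtain h where h: "core K h"
    using core_exists[OF K] .
  have ne: "K i \<inter> K j = {}" if "i < l" "j < l" "i \<noteq> j" for i j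
    using hole_ringD(4)[OF K] that by blast
  have adjD: "i < l" "j < l" "i \<noteq> j" if "cycle_adj l i j" for i j
    using that l6 by (auto simp: cycle_adj_iff_l)
  have im: "edges_between E (K i) (K j) `` {a} = E `` {a} \<inter> K j" if "cycle_adj l i j" "a \<in> K i" for i j a
    using that ne adjD[OF that(1)] unfolding edges_between_def by blast
  have im': "edges_between E (K j) (K i) `` {a} = E `` {a} \<inter> K j" if "cycle_adj l i j" "a \<in> K i" for i j a
    using that ne adjD[OF that(1)] unfolding edges_between_def by blast
  have half: "half_graph (K i) (K j) (edges_between E (K i) (K j))" if ij: "cycle_adj l i j" for i j
    unfolding half_graph_def
  proof (intro conjI ballI)
    show "edges_between E (K i) (K j) \<subseteq> K i \<times> K j \<union> K j \<times> K i"
      unfolding edges_between_def by auto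
    show "sym (edges_between E (K i) (K j))"
      using sym_E unfolding edges_between_def sym_def by auto
    show "edges_between E (K i) (K j) `` {a} \<subseteq> edges_between E (K i) (K j) `` {a'} \<or>
        edges_between E (K i) (K j) `` {a'} \<subseteq> edges_between E (K i) (K j) `` {a}"
      if a: "a \<in> K i" "a' \<in> K i" for a a'
      unfolding im[OF ij a(1)] im[OF ij a(2)] using ring_nested[OF K ij a] by blast
  qed
  have con: "connected_graph (K i \<union> K j) (edges_between E (K i) (K j))" if ij: "cycle_adj l i j" for i j
  proof -
    let ?F = "edges_between E (K i) (K j)"
    have ji: "cycle_adj l j i"
      using ij cycle_adj_sym by blast
    have F: "sym ?F"
      using half[OF ij] unfolding half_graph_def by auto
    have hi: "(u, h i) \<in> ?F" if "u \<in> K j" for u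
      using coreD(1)[OF h adjD(1)[OF ij]] coreD(3)[OF h ij that] that unfolding edges_between_def by auto
    have hj: "(u, h j) \<in> ?F" if "u \<in> K i" for u
      using coreD(1)[OF h adjD(2)[OF ij]] coreD(3)[OF h ji that] that unfolding edges_between_def by auto
    have "(u, h i) \<in> ?F\<^sup>*" if "u \<in> K i \<union> K j" for u
      using that hi hj coreD(1)[OF h adjD(2)[OF ij]]
      by (meson UnE r_into_rtrancl rtrancl_into_rtrancl)
    then show ?thesis
      unfolding connected_graph_def using sym_rtrancl[OF F] by (meson rtrancl_trans symD)
  qed
  have comp: "compatible (K v) (edges_between E (K x) (K v)) (edges_between E (K y) (K v))"
    if xy: "x \<noteq> y" "cycle_adj l v x" "cycle_adj l v y" for v x y
    unfolding compatible_def
  proof (intro ballI)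
    fix a a' assume a: "a \<in> K v" "a' \<in> K v"
    show "(edges_between E (K x) (K v) \<union> edges_between E (K y) (K v)) `` {a}
        \<subseteq> (edges_between E (K x) (K v) \<union> edges_between E (K y) (K v)) `` {a'} \<or>
      (edges_between E (K x) (K v) \<union> edges_between E (K y) (K v)) `` {a'}
        \<subseteq> (edges_between E (K x) (K v) \<union> edges_between E (K y) (K v)) `` {a}"
    proof (rule ccontr)
      assume "\<not> ?thesis"
      then obtain b c where bc: "b \<in> K x \<union> K y" "(a, b) \<in> E" "(a', b) \<notin> E"
        "c \<in> K x \<union> K y" "(a', c) \<in> E" "(a, c) \<notin> E"
        unfolding Un_Image im'[OF xy(2) a(1)] im'[OF xy(2) a(2)] im'[OF xy(3) a(1)] im'[OF xy(3) a(2)]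
        by blast
      from bc(1,4) consider "b \<in> K x" "c \<in> K x" | "b \<in> K y" "c \<in> K y" | "b \<in> K x" "c \<in> K y"
        | "b \<in> K y" "c \<in> K x" by blast
      then show False
      proof cases
        case 1
        then show False using ring_nested[OF K xy(2) a] bc by blast
      next
        case 2
        then show False using ring_nested[OF K xy(3) a] bc by blast
      next
        case 3
        then show False using ring_cross[OF K xy(2,3,1) a] bc by blast
      next
        case 4
        then show False using ring_cross[OF K xy(3,2) xy(1)[symmetric] a] bc by blast
      qed
    qed
  qed
  have "edges_between E (K i) (K j) = {}" if "i < l" "j < l" "i \<noteq> j" "\<not> cycle_adj l i j" for i j
    using hole_ringD(5)[OF K that(1,2)] that adj_commute unfolding edges_between_def by blast
  moreover have "disjoint_family_on K {..<l}"
    using ne unfolding disjoint_family_on_def by auto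
  moreover have "K i \<noteq> {} \<and> clique E (K i)" if "i < l" for i
    using K that unfolding hole_ring_def by auto
  ultimately show ?thesis
    unfolding inflated_hole_def using V half con comp l6
    by (intro conjI exI[of _ K]) auto
qed

section \<open>Holes with one vertex in each clique\<close>

lemma hole_map_transversal:
  assumes K: "hole_ring K" and g: "\<And>i. i < l \<Longrightarrow> g i \<in> K i" "\<And>i. i < l \<Longrightarrow> (g i, g (Suc i mod l)) \<in> E"
  shows "hole_map g"
  unfolding hole_map_def
proof (intro allI impI conjI)
  fix i j assume ij: "i < l" "j < l"
  show "g i = g j \<longleftrightarrow> i = j"
    using hole_ringD(4)[OF K ij, of "g i"] g(1) ij by auto
  show "(g i, g j) \<in> E \<longleftrightarrow> cycle_adj l i j"
  proof
    assume "(g i, g j) \<in> E"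
    then show "cycle_adj l i j"
      using hole_ringD(5)[OF K ij g(1) g(1)] ij by auto
  next
    assume "cycle_adj l i j"
    then show "(g i, g j) \<in> E"
      using g(2) ij adj_commute unfolding cycle_adj_def by metis
  qed
qed

text \<open>A core vertex is adjacent to whatever stands next to it, so an edge needs checking only
  where two consecutive positions both deviate from the core.\<close>

lemma hole_map_core:
  assumes K: "hole_ring K" and h: "core K h" and g: "\<And>i. i < l \<Longrightarrow> g i \<in> K i"
    and e: "\<And>i. i < l \<Longrightarrow> g i \<noteq> h i \<Longrightarrow> g (Suc i mod l) \<noteq> h (Suc i mod l) \<Longrightarrow>
      (g i, g (Suc i mod l)) \<in> E"
  shows "hole_map g"
proof (rule hole_map_transversal[OF K g])
  fix i assume i: "i < l"
  then have "cycle_adj l i (Suc i mod l)" "cycle_adj l (Suc i mod l) i" "Suc i mod l < l"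
    unfolding cycle_adj_def by auto
  then show "(g i, g (Suc i mod l)) \<in> E"
    using coreD(2,3)[OF h] g i e by metis
qed

lemma hole_map_core_self: "hole_ring K \<Longrightarrow> core K h \<Longrightarrow> hole_map h"
  using hole_map_core[of K h h] coreD(1)[of K h] by simp

lemma hole_map_core_update:
  assumes "hole_ring K" "core K h" "k < l" "w \<in> K k"
  shows "hole_map (h(k := w))"
proof (rule hole_map_core[OF assms(1,2)])
  fix i assume "i < l" "(h(k := w)) i \<noteq> h i" "(h(k := w)) (Suc i mod l) \<noteq> h (Suc i mod l)"
  then have "i = k" "Suc i mod l = k"
    by (auto split: if_splits)
  then have "Suc i mod l = i" by simp
  then have False
    using \<open>i < l\<close> l6 by (cases "Suc i = l") auto
  then show "((h(k := w)) i, (h(k := w)) (Suc i mod l)) \<in> E" ..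
qed (use assms in \<open>auto simp: coreD(1)[OF assms(2)]\<close>)

lemma hole_map_core_update2:
  assumes "hole_ring K" "core K h" "k < l" "w \<in> K k" "k' < l" "w' \<in> K k'" "k \<noteq> k'" "\<not> cycle_adj l k k'"
  shows "hole_map (h(k := w, k' := w'))"
proof (rule hole_map_core[OF assms(1,2)])
  fix i assume i: "i < l" "(h(k := w, k' := w')) i \<noteq> h i"
    "(h(k := w, k' := w')) (Suc i mod l) \<noteq> h (Suc i mod l)"
  then have "i \<in> {k, k'}" "Suc i mod l \<in> {k, k'}"
    by (auto split: if_splits)
  moreover have "cycle_adj l i (Suc i mod l)" "Suc i mod l \<noteq> i"
    using i(1) l6 unfolding cycle_adj_def by (cases "Suc i = l"; auto)+
  ultimately have False
    using assms(8) cycle_adj_sym by auto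
  then show "((h(k := w, k' := w')) i, (h(k := w, k' := w')) (Suc i mod l)) \<in> E" ..
qed (use assms in \<open>auto simp: coreD(1)[OF assms(2)]\<close>)

lemma far_index:
  assumes "c < l"
  obtains e where "e < l" "e \<noteq> k" "e \<noteq> c" "\<not> cycle_adj l c e"
proof -
  \<comment> \<open>Two candidates outside the closed neighbourhood of \<open>c\<close>; at least
    one of them differs from \<open>k\<close>.\<close>
  define e1 where "e1 = (if c + 2 < l then c + 2 else c + 2 - l)"
  define e2 where "e2 = (if c + 3 < l then c + 3 else c + 3 - l)"
  have "e1 < l" "e1 \<noteq> c" "\<not> cycle_adj l c e1" "e2 < l" "e2 \<noteq> c" "\<not> cycle_adj l c e2" "e1 \<noteq> e2"
    unfolding e1_def e2_def using assms l6 by (auto simp: cycle_adj_iff_l)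
  then show thesis
    using that by metis
qed

lemma two_far_indices:
  assumes "c < l"
  obtains e e' where "e < l" "e' < l" "e \<noteq> c" "e' \<noteq> c" "e \<noteq> e'" "\<not> cycle_adj l e e'"
proof -
  define e1 where "e1 = (if c + 1 < l then c + 1 else c + 1 - l)"
  define e2 where "e2 = (if c + 3 < l then c + 3 else c + 3 - l)"
  have "e1 < l" "e1 \<noteq> c" "e2 < l" "e2 \<noteq> c" "e1 \<noteq> e2" "\<not> cycle_adj l e1 e2"
    unfolding e1_def e2_def using assms l6 by (auto simp: cycle_adj_iff_l)
  then show thesis
    using that by metis
qed

section \<open>Neighbours in the ring of a vertex outside it\<close>

text \<open>\<open>v\<close> sees at least \<open>l - 1 \<ge> 5\<close> vertices of the updated
  hole, whereas the incomplete outcome of \<open>hole_nbrs\<close> leaves only three.\<close>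

lemma complete_update:
  assumes g: "hole_map (g(k := u))" and k: "k < l" and v: "\<And>i. i < l \<Longrightarrow> v \<noteq> (g(k := u)) i"
    and nbr: "\<And>i. i < l \<Longrightarrow> i \<noteq> k \<Longrightarrow> (v, g i) \<in> E"
  shows "(v, u) \<in> E"
proof -
  obtain e e' where e: "e < l" "e' < l" "e \<noteq> k" "e' \<noteq> k" "e \<noteq> e'" "\<not> cycle_adj l e e'"
    using two_far_indices[OF k] .
  then consider "\<forall>i<l. (v, (g(k := u)) i) \<in> E"
    | c where "c < l" "\<forall>i<l. (v, (g(k := u)) i) \<in> E \<longleftrightarrow> i = c \<or> cycle_adj l c i"
    using hole_nbrs[OF g v, of e e'] nbr by auto
  then show ?thesis
  proof cases
    case 1
    then show ?thesis using k by (auto dest: spec[of _ k])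
  next
    case (2 c)
    obtain d where d: "d < l" "d \<noteq> k" "d \<noteq> c" "\<not> cycle_adj l c d"
      using far_index[OF 2(1)] .
    then have "(v, (g(k := u)) d) \<in> E"
      using nbr by auto
    with 2 d show ?thesis by blast
  qed
qed

lemma hole_map_update_core:
  assumes K: "hole_ring K" and h: "core K h" and g: "\<And>i. i < l \<Longrightarrow> g i \<in> K i" "hole_map g" and k: "k < l"
  shows "hole_map (g(k := h k))"
proof (rule hole_map_transversal[OF K])
  fix j assume j: "j < l"
  show "(g(k := h k)) j \<in> K j"
    using g(1)[OF j] coreD(1)[OF h k] by auto
  have adj: "cycle_adj l j (Suc j mod l)" "Suc j mod l < l"
    using j unfolding cycle_adj_def by auto
  then have "cycle_adj l (Suc j mod l) j" "(g j, g (Suc j mod l)) \<in> E"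
    using hole_mapD(2)[OF g(2) j adj(2)] cycle_adj_sym by auto
  then show "((g(k := h k)) j, (g(k := h k)) (Suc j mod l)) \<in> E"
    using coreD[OF h] adj g(1) j k by auto
qed

text \<open>The vertex \<open>u\<close> cannot be put into \<open>g\<close> directly, as it need not
  be adjacent to the vertices of \<open>g\<close> beside it. So \<open>v\<close> is first shown to
  see each core vertex, by replacing single vertices of \<open>g\<close>; then \<open>u\<close>
  replaces a vertex of the core.\<close>

lemma complete_if_complete_transversal:
  assumes K: "hole_ring K" and h: "core K h" and g: "\<And>i. i < l \<Longrightarrow> g i \<in> K i" "hole_map g"
    and v: "v \<notin> (\<Union>i<l. K i)" and nbr: "\<And>i. i < l \<Longrightarrow> (v, g i) \<in> E" and u: "u \<in> K k" "k < l"
  shows "(v, u) \<in> E"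
proof -
  have vn: "v \<noteq> w" if "w \<in> K i" "i < l" for w i
    using that v by auto
  have vh: "(v, h i) \<in> E" if i: "i < l" for i
  proof (rule complete_update[of g i])
    show "hole_map (g(i := h i))"
      by (rule hole_map_update_core[OF K h g i])
    show "v \<noteq> (g(i := h i)) j" if "j < l" for j
      using vn g(1) coreD(1)[OF h] i that by auto
  qed (use i nbr in auto)
  show ?thesis
  proof (rule complete_update[OF hole_map_core_update[OF K h u(2,1)] u(2)])
    show "v \<noteq> (h(k := u)) j" if "j < l" for j
      using vn coreD(1)[OF h] u that by auto
  qed (use vh in auto)
qed

text \<open>The walk from \<open>w'\<close> the long way round to \<open>w\<close> meets every
  clique once. As \<open>w\<close> and \<open>w'\<close> are nonadjacent it is an induced path on
  \<open>l\<close> vertices instead of a hole, so anything that closes it up gives a hole longer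
  than \<open>l\<close>.\<close>

lemma ring_arc:
  assumes K: "hole_ring K" and h: "core K h" and w: "w \<in> K 0" and w': "w' \<in> K 1" and n: "(w, w') \<notin> E"
  shows "induced_path E l (\<lambda>d. if d = 0 then w' else if d = l - 1 then w else h (Suc d))"
  unfolding induced_path_def
proof (intro allI impI)
  fix i j assume ij: "i < l" "j < l" "i < j"
  \<comment> \<open>The clique in which position \<open>d\<close> of the path lies: the path starts
    in clique 1 and ends in clique 0.\<close>
  define c where "c d = (if d = l - 1 then 0 else Suc d)" for d
  define q where "q d = (if d = 0 then w' else if d = l - 1 then w else h (Suc d))" for d
  have qK: "q d \<in> K (c d)" "c d < l" if "d < l" for d
    unfolding q_def c_def using w w' coreD(1)[OF h, of "Suc d"] that l6 by auto
  have cc: "c i \<noteq> c j" "cycle_adj l (c i) (c j) \<longleftrightarrow> j = Suc i \<or> i = 0 \<and> j = l - 1"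
    unfolding c_def using ij l6 by (auto simp: cycle_adj_iff_l)
  have "q i \<noteq> q j"
    using hole_ringD(4)[OF K qK(2)[OF ij(1)] qK(2)[OF ij(2)] qK(1)[OF ij(1)]] qK(1)[OF ij(2)] cc(1) by metis
  moreover have "(q i, q j) \<in> E \<longleftrightarrow> j = Suc i"
  proof
    assume a: "(q i, q j) \<in> E"
    then have "cycle_adj l (c i) (c j)"
      using hole_ringD(5)[OF K qK(2)[OF ij(1)] qK(2)[OF ij(2)] qK(1)[OF ij(1)] qK(1)[OF ij(2)]] cc(1) by blast
    then show "j = Suc i"
      unfolding cc(2) using a n adj_commute[of w w'] l6 by (auto simp: q_def)
  next
    assume j: "j = Suc i"
    then have adj: "cycle_adj l (c i) (c j)" "cycle_adj l (c j) (c i)"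
      using cc(2) cycle_adj_sym by auto
    have "q i = h (c i) \<or> q j = h (c j)"
      unfolding q_def c_def using j ij l6 by auto
    then show "(q i, q j) \<in> E"
      using coreD(2)[OF h adj(1) qK(1)[OF ij(2)]] coreD(3)[OF h adj(2) qK(1)[OF ij(1)]] by metis
  qed
  ultimately show "(if i = 0 then w' else if i = l - 1 then w else h (Suc i)) \<noteq>
        (if j = 0 then w' else if j = l - 1 then w else h (Suc j)) \<and>
      ((if i = 0 then w' else if i = l - 1 then w else h (Suc i),
        if j = 0 then w' else if j = l - 1 then w else h (Suc j)) \<in> E \<longleftrightarrow> j = Suc i)"
    unfolding q_def by (rule conjI)
qed

text \<open>Makes \<open>hole_nbrs\<close> applicable to a vertex with two nonadjacent neighbours
  anywhere in the ring. In nonconsecutive cliques they are simply put into the core. In consecutive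
  cliques, excluding holes of length 4 shows that \<open>v\<close> sees \<open>h i\<close> and
  \<open>h j\<close>, and excluding a hole of length \<open>l + 1\<close> gives a further neighbour
  in the core.\<close>

lemma transversal_nonadjacent_nbrs:
  assumes K: "hole_ring K" and h: "core K h" and v: "v \<notin> (\<Union>i<l. K i)"
    and w: "w \<in> K i" "i < l" and w': "w' \<in> K j" "j < l"
    and n: "w \<noteq> w'" "(w, w') \<notin> E" and vw: "(v, w) \<in> E" "(v, w') \<in> E"
  obtains g s t where "hole_map g" "\<And>i. i < l \<Longrightarrow> g i \<in> K i" "s < l" "t < l" "s \<noteq> t" "\<not> cycle_adj l s t"
    "(v, g s) \<in> E" "(v, g t) \<in> E"
proof (cases "cycle_adj l i j")
  case False
  have "i \<noteq> j"
    using hole_ringD(3)[OF K w(2,1)] w' n by auto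
  show thesis
  proof (rule that[of "h(i := w, j := w')" i j])
    show "hole_map (h(i := w, j := w'))"
      by (rule hole_map_core_update2[OF K h w(2,1) w'(2,1) \<open>i \<noteq> j\<close> False])
  qed (use w w' vw False \<open>i \<noteq> j\<close> coreD(1)[OF h] in auto)
next
  case True
  then have ji: "cycle_adj l j i"
    using cycle_adj_sym by blast
  have hi: "h i \<in> K i" "h j \<in> K j"
    using coreD(1)[OF h] w w' by auto
  have hw: "(h i, w') \<in> E" "(w, h j) \<in> E"
    using coreD(2)[OF h True w'(1)] coreD(3)[OF h ji w(1)] by auto
  then have "h i \<noteq> w" "h j \<noteq> w'"
    using n by auto
  then have ww: "(w, h i) \<in> E" "(h j, w') \<in> E"
    using hole_ringD(3)[OF K w(2,1) hi(1)] hole_ringD(3)[OF K w'(2) hi(2) w'(1)] by auto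
  have vn: "v \<noteq> u" if "u \<in> K k" "k < l" for u k
    using that v by auto
  have vi: "(v, h i) \<in> E"
    using no_hole4[of v w "h i" w'] vw ww hw n vn hi w w' adj_commute by blast
  have vj: "(v, h j) \<in> E"
    using no_hole4[of v w "h j" w'] vw ww hw n vn hi w w' adj_commute by blast
  \<comment> \<open>Otherwise \<open>v\<close> sees only the ends of the long path from
    \<open>w'\<close> to \<open>w\<close> and closes it to a hole.\<close>
  have "\<exists>k<l. k \<noteq> i \<and> k \<noteq> j \<and> (v, h k) \<in> E"
  proof (rule ccontr)
    assume none: "\<not> ?thesis"
    obtain \<sigma> where \<sigma>: "cycle_aut l \<sigma>" "\<sigma> 0 = i" "\<sigma> 1 = j"
      using cycle_aut_exists[OF _ True] l6 by auto
    let ?q = "\<lambda>d. if d = 0 then w' else if d = l - 1 then w else h (\<sigma> (Suc d))"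
    have "1 + l = l"
    proof (rule join_paths[where p = "\<lambda>_. v" and q = ?q])
      show "induced_path E l ?q"
        using ring_arc[OF hole_ring_aut(1)[OF K \<sigma>(1)] core_aut[OF h \<sigma>(1)], of w w'] w w' n \<sigma> by simp
      show "induced_path E 1 (\<lambda>_. v)"
        unfolding induced_path_def by auto
      show "v \<noteq> ?q d \<and> ((v, ?q d) \<in> E \<longleftrightarrow> a = 1 - 1 \<and> d = 0 \<or> a = 0 \<and> d = l - 1)"
        if "a < 1" "d < l" for a d :: nat
      proof -
        consider "d = 0" | "d = l - 1" | "0 < d" "Suc d < l" "d \<noteq> l - 1"
          using \<open>d < l\<close> by linarith
        then show ?thesis
        proof cases
          case 3
          have s: "\<sigma> (Suc d) < l" "\<sigma> (Suc d) \<noteq> \<sigma> 0" "\<sigma> (Suc d) \<noteq> \<sigma> 1"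
            using cycle_autD(1,2)[OF \<sigma>(1)] 3 l6 by auto
          then have "(v, h (\<sigma> (Suc d))) \<notin> E"
            using none \<sigma> by auto
          moreover have "v \<noteq> h (\<sigma> (Suc d))"
            using vn[OF coreD(1)[OF h s(1)] s(1)] .
          ultimately show ?thesis
            using 3 by auto
        qed (use vw vn[OF w] vn[OF w'] that in auto)
      qed
    qed (use l6 in auto)
    then show False by auto
  qed
  then obtain k where k: "k < l" "k \<noteq> i" "k \<noteq> j" "(v, h k) \<in> E"
    by auto
  \<comment> \<open>No third index is adjacent to both of two consecutive ones, so \<open>k\<close>
    and one of \<open>i\<close>, \<open>j\<close> are the required positions.\<close>
  have "\<not> cycle_adj l i k \<or> \<not> cycle_adj l j k"
    using True k l6 by (auto simp: cycle_adj_iff_l)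
  then show thesis
    using that[OF hole_map_core_self[OF K h] coreD(1)[OF h], of i k]
      that[OF hole_map_core_self[OF K h] coreD(1)[OF h], of j k] w(2) w'(2) vi vj k by auto
qed

text \<open>The nonneighbour at \<open>e\<close> rules out the complete outcome of
  \<open>hole_nbrs\<close>, and 1 is the only possible centre of three consecutive neighbours that
  include 0 and 2.\<close>

lemma nbrs_centred_at_1:
  assumes g: "hole_map g" and v: "\<And>i. i < l \<Longrightarrow> v \<noteq> g i"
    and n: "(v, g 0) \<in> E" "(v, g 2) \<in> E" "3 \<le> e" "e < l" "(v, g e) \<notin> E" and k: "k < l"
  shows "(v, g k) \<in> E \<longleftrightarrow> k \<le> 2"
proof -
  have "\<not> cycle_adj l 0 2"
    using l6 by (auto simp: cycle_adj_iff_l)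
  then obtain c where c: "c < l" "\<And>i. i < l \<Longrightarrow> (v, g i) \<in> E \<longleftrightarrow> i = c \<or> cycle_adj l c i"
    using hole_nbrs[OF g v, of 0 2] n l6 by force
  have "0 = c \<or> cycle_adj l c 0" "2 = c \<or> cycle_adj l c 2"
    using c(2)[of 0] c(2)[of 2] n l6 by auto
  then have "c = 1"
    using l6 by (auto simp: cycle_adj_iff_l)
  then show ?thesis
    using c(2)[OF k] k l6 by (auto simp: cycle_adj_iff_l)
qed

text \<open>If \<open>v\<close> sees exactly three consecutive vertices of a transversal, it extends the middle clique.
  The only obstruction is a prism with paths of length two, which needs \<open>l = 6\<close>.\<close>

lemma ring_insert_at_1:
  assumes K: "hole_ring K" and h: "core K h" and g: "hole_map g" "\<And>i. i < l \<Longrightarrow> g i \<in> K i"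
    and v: "v \<in> V" "v \<notin> (\<Union>i<l. K i)"
    and nbr: "\<And>i. i < l \<Longrightarrow> (v, g i) \<in> E \<longleftrightarrow> i \<le> 2"
    and nm: "\<not> mated"
  shows "hole_ring (K(1 := insert v (K 1)))"
proof -
  have l: "0 < l" "1 < l" "2 < l" "3 < l" "4 < l" "5 < l" "l - 1 < l"
    using l6 by auto
  have vn: "v \<noteq> u" if "u \<in> K k" "k < l" for u k
    using that v by auto
  have hK: "h i \<in> K i" if "i < l" for i
    using coreD(1)[OF h that] .
  have sm: "Suc i mod l = (if i = l - 1 then 0 else Suc i)" if "i < l" for i
    using that by auto
  have upd: "hole_map (g(k := h k))" if k: "k < l" for k
    by (rule hole_map_update_core[OF K h g(2,1) k])
  have vg: "v \<noteq> (g(k := h k)) i" if "i < l" "k < l" for i k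
    using vn g(2) hK that by auto
  have other: "\<exists>e. 3 \<le> e \<and> e < l \<and> e \<noteq> k" for k
    using l by (intro exI[of _ "if k = 3 then 4 else 3"]) auto
  \<comment> \<open>Replacing \<open>g k\<close> by \<open>h k\<close> keeps the neighbours at 0 and
    2 and some other nonneighbour \<open>e\<close>, so the pattern of neighbours persists.\<close>
  have far: "(v, h k) \<notin> E" if "3 \<le> k" "k < l" for k
  proof -
    obtain e where e: "3 \<le> e" "e < l" "e \<noteq> k"
      using other by auto
    have "(v, (g(k := h k)) k) \<in> E \<longleftrightarrow> k \<le> 2"
      using nbrs_centred_at_1[OF upd[OF that(2)], of v e k] vg e nbr[of 0] nbr[of 2] nbr[of e] that l by auto
    then show ?thesis
      using that by auto
  qed
  have v1: "(v, h 1) \<in> E"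
  proof -
    have "(v, (g(1 := h 1)) 1) \<in> E \<longleftrightarrow> (1::nat) \<le> 2"
      using nbrs_centred_at_1[OF upd[OF l(2)], of v 3 1] vg nbr[of 0] nbr[of 2] nbr[of 3] l by auto
    then show ?thesis
      by auto
  qed
  have none: "(v, w) \<notin> E" if k: "3 \<le> k" "k < l" and w: "w \<in> K k" for k w
  proof
    assume vw: "(v, w) \<in> E"
    \<comment> \<open>A hole through \<open>w\<close> in which \<open>v\<close> sees positions 1 and
      \<open>k\<close>. It retains \<open>g 0\<close> and \<open>g 2\<close>, except beside
      \<open>w\<close>, where the core is needed. The centre of the neighbours of \<open>v\<close>
      would have to be 0 or 2, and then the retained vertex on the other side, also seen by
      \<open>v\<close>, is too far away.\<close>
    define f where "f i = (if i = k then w else if i = 0 \<and> k \<noteq> l - 1 \<or> i = 2 \<and> k \<noteq> 3 then g i else h i)" for i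
    have fK: "f i \<in> K i" if "i < l" for i
      using that w g(2) hK unfolding f_def by auto
    have f: "hole_map f"
    proof (rule hole_map_core[OF K h fK])
      fix i assume i: "i < l" "f i \<noteq> h i" "f (Suc i mod l) \<noteq> h (Suc i mod l)"
      then have "i = k \<or> i = 0 \<and> k \<noteq> l - 1 \<or> i = 2 \<and> k \<noteq> 3"
        "Suc i mod l = k \<or> Suc i mod l = 0 \<and> k \<noteq> l - 1 \<or> Suc i mod l = 2 \<and> k \<noteq> 3"
        unfolding f_def by (auto split: if_splits)
      then have False
        unfolding sm[OF i(1)] using k l6 by (auto split: if_splits)
      then show "(f i, f (Suc i mod l)) \<in> E" ..
    qed
    have vf: "v \<noteq> f i" if "i < l" for i
      using vn[OF fK[OF that] that] .
    have f1: "(v, f 1) \<in> E" "(v, f k) \<in> E"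
      using v1 vw k unfolding f_def by auto
    have "\<not> cycle_adj l 1 k" "1 \<noteq> k"
      using k by (auto simp: cycle_adj_iff_l)
    then consider "\<forall>i<l. (v, f i) \<in> E"
      | c where "c < l" "\<forall>i<l. (v, f i) \<in> E \<longleftrightarrow> i = c \<or> cycle_adj l c i"
      using hole_nbrs[OF f vf l(2) k(2)] f1 by auto
    then show False
    proof cases
      case 1
      obtain e where e: "3 \<le> e" "e < l" "e \<noteq> k"
        using other by auto
      then have "f e = h e"
        unfolding f_def by auto
      then show False
        using far[OF e(1,2)] 1 e by metis
    next
      case (2 c)
      have "1 = c \<or> cycle_adj l c 1" "k = c \<or> cycle_adj l c k"
        using 2(2) f1 k l by blast+
      then have c: "c = 0 \<and> k = l - 1 \<or> c = 2 \<and> k = 3"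
        using k l6 by (auto simp: cycle_adj_iff_l)
      have g02: "(v, g 0) \<in> E" "(v, g 2) \<in> E"
        using nbr l by auto
      from c show False
      proof (elim disjE conjE)
        assume c: "c = 0" "k = l - 1"
        then have "f 2 = g 2"
          using l6 unfolding f_def by auto
        then have "2 = c \<or> cycle_adj l c 2"
          using 2(2) g02(2) l(3) by metis
        then show False
          using c l6 by (auto simp: cycle_adj_iff_l)
      next
        assume c: "c = 2" "k = 3"
        then have "f 0 = g 0"
          using l6 unfolding f_def by auto
        then have "0 = c \<or> cycle_adj l c 0"
          using 2(2) g02(1) l(1) by metis
        then show False
          using c l6 by (auto simp: cycle_adj_iff_l)
      qed
    qed
  qed
  have adj01: "cycle_adj l 0 1" "cycle_adj l 1 0" "cycle_adj l 1 2" "cycle_adj l 2 1"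
    using l6 by (auto simp: cycle_adj_iff_l)
  have nadj: "(a, b) \<notin> E" if "a \<in> K i" "b \<in> K j" "i < l" "j < l" "i \<noteq> j" "\<not> cycle_adj l i j" for a b i j
    using hole_ringD(5)[OF K that(3,4,1,2)] that by blast
  have n02: "\<not> cycle_adj l 0 2"
    using l6 by (auto simp: cycle_adj_iff_l)
  have full: "(v, w) \<in> E" if w: "w \<in> K 1" for w
  proof (rule ccontr)
    assume vw: "(v, w) \<notin> E"
    have hw: "(h 0, w) \<in> E" "(w, h 2) \<in> E"
      using coreD(2)[OF h adj01(1) w] coreD(3)[OF h adj01(4) w] by auto
    have vg: "(v, g 0) \<in> E" "(v, g 2) \<in> E"
      using nbr l by auto
    have left: "(v, h 0) \<notin> E \<and> (g 0, w) \<notin> E \<and> (g 0, h 0) \<in> E" if no: "\<not> (\<exists>a\<in>K 0. (v, a) \<in> E \<and> (a, w) \<in> E)"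
      using no hw vg g(2)[OF l(1)] hK[OF l(1)] hole_ringD(3)[OF K l(1)] by metis
    have right: "(v, h 2) \<notin> E \<and> (g 2, w) \<notin> E \<and> (g 2, h 2) \<in> E" if no: "\<not> (\<exists>a\<in>K 2. (v, a) \<in> E \<and> (a, w) \<in> E)"
      using no hw vg g(2)[OF l(3)] hK[OF l(3)] hole_ringD(3)[OF K l(3)] adj_commute by metis
    \<comment> \<open>Split by whether \<open>v\<close> and \<open>w\<close> have a common neighbour
      in \<open>K 0\<close> and one in \<open>K 2\<close>. Both give a hole of length 4, exactly one
      a hole of length 5, and neither a hole of length 6.\<close>
    show False
    proof (cases "\<exists>a\<in>K 0. (v, a) \<in> E \<and> (a, w) \<in> E"; cases "\<exists>a\<in>K 2. (v, a) \<in> E \<and> (a, w) \<in> E")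
      assume "\<exists>a\<in>K 0. (v, a) \<in> E \<and> (a, w) \<in> E" "\<exists>a\<in>K 2. (v, a) \<in> E \<and> (a, w) \<in> E"
      then obtain a b where ab: "a \<in> K 0" "(v, a) \<in> E" "(a, w) \<in> E" "b \<in> K 2" "(v, b) \<in> E" "(b, w) \<in> E"
        by auto
      then show False
        using no_hole4[of v a w b] vw vn[OF w l(2)] adj_commute nadj[OF ab(1,4)] n02 l
          hole_ringD(4)[OF K l(1,3) ab(1)] by auto
    next
      assume "\<exists>a\<in>K 0. (v, a) \<in> E \<and> (a, w) \<in> E" and no: "\<not> (\<exists>a\<in>K 2. (v, a) \<in> E \<and> (a, w) \<in> E)"
      then obtain a where a: "a \<in> K 0" "(v, a) \<in> E" "(a, w) \<in> E"
        by auto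
      show False
        using no_hole5[of v a w "h 2" "g 2"] a hw right[OF no] vg vw adj_commute
          nadj[OF a(1) hK[OF l(3)]] nadj[OF a(1) g(2)[OF l(3)]] n02 l by auto
    next
      assume no: "\<not> (\<exists>a\<in>K 0. (v, a) \<in> E \<and> (a, w) \<in> E)" and "\<exists>a\<in>K 2. (v, a) \<in> E \<and> (a, w) \<in> E"
      then obtain a where a: "a \<in> K 2" "(v, a) \<in> E" "(a, w) \<in> E"
        by auto
      show False
        using no_hole5[of v a w "h 0" "g 0"] a hw left[OF no] vg vw adj_commute
          nadj[OF hK[OF l(1)] a(1)] nadj[OF g(2)[OF l(1)] a(1)] n02 l by auto
    next
      assume "\<not> (\<exists>a\<in>K 0. (v, a) \<in> E \<and> (a, w) \<in> E)" "\<not> (\<exists>a\<in>K 2. (v, a) \<in> E \<and> (a, w) \<in> E)"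
      note lr = left[OF this(1)] right[OF this(2)]
      have nn: "(a, b) \<notin> E" "(b, a) \<notin> E" if "a \<in> {g 0, h 0}" "b \<in> {g 2, h 2}" for a b
        using nadj[of a 0 b 2] that hK g(2) n02 l adj_commute by auto
      have "l = 6"
        by (rule hole6[of v "g 0" "h 0" w "h 2" "g 2"])
          (use lr nn hw vg vw adj_commute in auto)
      have i: "h 5 \<in> K 5" "h 4 \<in> K 4" "h 3 \<in> K 3" "h 0 \<in> K 0" "h 2 \<in> K 2" "g 0 \<in> K 0" "g 2 \<in> K 2"
        using hK g(2) l by auto
      have c6: "cycle_adj l 5 0" "cycle_adj l 4 5" "cycle_adj l 4 3" "cycle_adj l 3 2"
        "\<not> cycle_adj l 4 0" "\<not> cycle_adj l 4 1" "\<not> cycle_adj l 4 2" "\<not> cycle_adj l 5 1"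
        "\<not> cycle_adj l 5 2" "\<not> cycle_adj l 5 3" "\<not> cycle_adj l 0 3" "\<not> cycle_adj l 0 4"
        "\<not> cycle_adj l 1 3" "\<not> cycle_adj l 1 4" "\<not> cycle_adj l 1 5"
        by (simp_all add: cycle_adj_iff \<open>l = 6\<close>)
      \<comment> \<open>The prism: triangles \<open>A\<close> and \<open>B\<close>, joined by three
        paths of length two whose middle vertices are the toes. Two of the paths run through
        \<open>v\<close> and \<open>w\<close>, the third goes round the far side of the ring through
        \<open>h 4\<close>.\<close>
      define A where "A = {g 0, h 0, h 5}"
      define B where "B = {g 2, h 2, h 3}"
      define T where "T = {v, w, h 4}"
      have e5: "(h 5, g 0) \<in> E" "(h 5, h 0) \<in> E" "(h 4, h 5) \<in> E" "(h 4, h 3) \<in> E"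
        "(h 3, g 2) \<in> E" "(h 3, h 2) \<in> E"
        using coreD(2)[OF h] c6 i by auto
      have ne: "(h 4, g 0) \<notin> E" "(h 4, h 0) \<notin> E" "(h 4, w) \<notin> E" "(h 4, g 2) \<notin> E" "(h 4, h 2) \<notin> E"
        "(h 5, w) \<notin> E" "(h 5, g 2) \<notin> E" "(h 5, h 2) \<notin> E" "(h 5, h 3) \<notin> E"
        "(g 0, h 3) \<notin> E" "(h 0, h 3) \<notin> E" "(w, h 3) \<notin> E"
        using nadj i w c6 l by auto
      have clA: "clique E A" and clB: "clique E B"
        using e5 lr adj_commute unfolding clique_def A_def B_def by auto
      have con: "connected_graph S (induced E S)" if "clique E S" for S
        using that unfolding connected_graph_def clique_def induced_def
        by (metis (no_types, lifting) IntI SigmaI r_into_rtrancl rtrancl.rtrancl_refl)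
      have vfar: "(v, h 3) \<notin> E" "(v, h 4) \<notin> E" "(v, h 5) \<notin> E"
        using far l by auto
      have disj: "a \<noteq> b" if "a \<in> K i" "b \<in> K j" "i < l" "j < l" "i \<noteq> j" for a b i j
        using hole_ringD(4)[OF K that(3,4,1)] that by auto
      have mated
      proof (rule mated_if_separated[of A T B])
        show "connected_graph A (induced E A)" "connected_graph B (induced E B)"
          using con clA clB by auto
        show "A \<subseteq> V" "B \<subseteq> V" "T \<subseteq> V"
          using hole_ringD(1)[OF K] i w v l unfolding A_def B_def T_def by blast+
        show "A \<inter> T = {}" "B \<inter> T = {}" "A \<inter> B = {}"
          unfolding A_def B_def T_def
          using disj i w l vn by auto
        have "v \<noteq> w" "v \<noteq> h 4" "w \<noteq> h 4"
          using vn w i disj[OF w i(2)] l by auto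
        then show "3 \<le> card T"
          unfolding T_def by auto
        show "(a, b) \<notin> E" if "a \<in> A" "b \<in> B" for a b
          using that nn ne unfolding A_def B_def by auto
        show "(s, t) \<notin> E" if "s \<in> T" "t \<in> T" for s t
          using that ne vfar vw adj_commute unfolding T_def by auto
        show "\<exists>!a. a \<in> A \<and> (t, a) \<in> E" if "t \<in> T" for t
        proof -
          have "\<exists>!a. a \<in> A \<and> (v, a) \<in> E"
            by (rule ex1I[of _ "g 0"]) (use vg vfar lr in \<open>auto simp: A_def\<close>)
          moreover have "\<exists>!a. a \<in> A \<and> (w, a) \<in> E"
            by (rule ex1I[of _ "h 0"]) (use hw lr ne adj_commute in \<open>auto simp: A_def\<close>)
          moreover have "\<exists>!a. a \<in> A \<and> (h 4, a) \<in> E"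
            by (rule ex1I[of _ "h 5"]) (use e5 ne in \<open>auto simp: A_def\<close>)
          ultimately show ?thesis
            using that unfolding T_def by auto
        qed
        show "\<exists>!b. b \<in> B \<and> (t, b) \<in> E" if "t \<in> T" for t
        proof -
          have "\<exists>!b. b \<in> B \<and> (v, b) \<in> E"
            by (rule ex1I[of _ "g 2"]) (use vg vfar lr in \<open>auto simp: B_def\<close>)
          moreover have "\<exists>!b. b \<in> B \<and> (w, b) \<in> E"
            by (rule ex1I[of _ "h 2"]) (use hw lr ne adj_commute in \<open>auto simp: B_def\<close>)
          moreover have "\<exists>!b. b \<in> B \<and> (h 4, b) \<in> E"
            by (rule ex1I[of _ "h 3"]) (use e5 ne in \<open>auto simp: B_def\<close>)
          ultimately show ?thesis
            using that unfolding T_def by auto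
        qed
      qed
      with nm show False by (rule notE)
    qed
  qed
  let ?K = "K(1 := insert v (K 1))"
  have v_only: "j = 1 \<or> cycle_adj l 1 j" if "u \<in> K j" "j < l" "(v, u) \<in> E" for u j
  proof -
    have "\<not> 3 \<le> j"
      using none[of j u] that by auto
    then have "j = 0 \<or> j = 1 \<or> j = 2"
      by auto
    then show ?thesis
      using adj01 by auto
  qed
  show ?thesis
    unfolding hole_ring_def
  proof (intro conjI allI impI ballI)
    fix i j assume ij: "i < l" "j < l"
    show "?K i \<subseteq> V" "?K i \<noteq> {}"
      using hole_ringD(1,2)[OF K ij(1)] v(1) by auto
    show "clique E (?K i)"
      unfolding clique_def using hole_ringD(3)[OF K ij(1)] full adj_commute by auto
    show "?K i \<inter> ?K j = {}" if "i \<noteq> j"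
      using hole_ringD(4)[OF K ij] v(2) ij that by auto
    show "i = j \<or> cycle_adj l i j" if u: "u \<in> ?K i" and w: "w \<in> ?K j" and e: "(u, w) \<in> E" for u w
    proof (cases "u \<in> K i"; cases "w \<in> K j")
      assume "u \<in> K i" "w \<in> K j"
      then show ?thesis
        using hole_ringD(5)[OF K ij] e by auto
    next
      assume "u \<in> K i" "w \<notin> K j"
      then show ?thesis
        using v_only[of u i] u w e ij adj_commute cycle_adj_sym by (auto split: if_splits)
    next
      assume "u \<notin> K i" "w \<in> K j"
      then show ?thesis
        using v_only[of w j] u w e ij by (auto split: if_splits)
    next
      assume "u \<notin> K i" "w \<notin> K j"
      then show ?thesis
        using u w by (auto split: if_splits)
    qed
    show "\<exists>w\<in>?K j. (u, w) \<in> E" if adj: "cycle_adj l i j" and u: "u \<in> ?K i" for u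
    proof (cases "u \<in> K i")
      case True
      then show ?thesis
        using hole_ringD(6)[OF K adj True] by auto
    next
      case False
      then have "i = 1" "u = v"
        using u by (auto split: if_splits)
      then have "j = 0 \<or> j = 2"
        using adj l6 by (auto simp: cycle_adj_iff_l)
      then show ?thesis
        using nbr[of 0] nbr[of 2] g(2)[of 0] g(2)[of 2] l \<open>u = v\<close> by auto
    qed
  qed
qed

text \<open>On a suitable hole \<open>v\<close> sees either everything or three consecutive
  vertices. In the second case \<open>v\<close> could be inserted into the middle clique, against
  the maximality of the ring.\<close>

lemma complete_if_nonadjacent_nbrs:
  assumes K: "hole_ring K" and nm: "\<not> mated"
    and max: "\<And>K'. hole_ring K' \<Longrightarrow> card (\<Union>i<l. K' i) \<le> card (\<Union>i<l. K i)"
    and v: "v \<in> V" "v \<notin> (\<Union>i<l. K i)"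
    and w: "w \<in> (\<Union>i<l. K i)" "w' \<in> (\<Union>i<l. K i)" "w \<noteq> w'" "(w, w') \<notin> E" "(v, w) \<in> E" "(v, w') \<in> E"
    and u: "u \<in> (\<Union>i<l. K i)"
  shows "(v, u) \<in> E"
proof -
  obtain h where h: "core K h"
    using core_exists[OF K] .
  obtain i j where ij: "w \<in> K i" "i < l" "w' \<in> K j" "j < l"
    using w by auto
  obtain g s t where g: "hole_map g" "\<And>i. i < l \<Longrightarrow> g i \<in> K i" and st: "s < l" "t < l" "s \<noteq> t"
    "\<not> cycle_adj l s t" "(v, g s) \<in> E" "(v, g t) \<in> E"
    using transversal_nonadjacent_nbrs[OF K h v(2) ij w(3-6)] by blast
  have vg: "v \<noteq> g k" if "k < l" for k
    using g(2)[OF that] v(2) that by auto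
  have "(\<forall>k<l. (v, g k) \<in> E) \<or> (\<exists>c<l. \<forall>k<l. (v, g k) \<in> E \<longleftrightarrow> k = c \<or> cycle_adj l c k)"
    using hole_nbrs[OF g(1) vg st] by simp
  then show ?thesis
  proof (elim disjE exE conjE)
    assume "\<forall>k<l. (v, g k) \<in> E"
    then show ?thesis
      using complete_if_complete_transversal[OF K h g(2,1) v(2)] u by auto
  next
    fix c assume c: "c < l" "\<forall>k<l. (v, g k) \<in> E \<longleftrightarrow> k = c \<or> cycle_adj l c k"
    \<comment> \<open>The predecessor of \<open>c\<close> on the cycle; with the edge from
      \<open>b\<close> to \<open>c\<close> an automorphism is available that takes 1 to
      \<open>c\<close>.\<close>
    define b where "b = (if c = 0 then l - 1 else c - 1)"
    have "cycle_adj l b c"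
      using c(1) l6 unfolding b_def by (auto simp: cycle_adj_iff_l)
    then obtain \<sigma> where \<sigma>: "cycle_aut l \<sigma>" "\<sigma> 1 = c"
      using cycle_aut_exists[of l b c] l6 by auto
    note aut = hole_ring_aut[OF K \<sigma>(1)]
    have "hole_ring ((\<lambda>i. K (\<sigma> i))(1 := insert v (K (\<sigma> 1))))"
    proof (rule ring_insert_at_1[OF aut(1) core_aut[OF h \<sigma>(1)] hole_map_aut[OF g(1) \<sigma>(1)] _ v(1) _ _ nm])
      show "v \<notin> (\<Union>i<l. K (\<sigma> i))"
        unfolding aut(2) using v(2) .
      fix k assume k: "k < l"
      show "g (\<sigma> k) \<in> K (\<sigma> k)"
        using g(2) cycle_autD(1)[OF \<sigma>(1) k] .
      have "(v, g (\<sigma> k)) \<in> E \<longleftrightarrow> \<sigma> k = \<sigma> 1 \<or> cycle_adj l (\<sigma> 1) (\<sigma> k)"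
        using c(2) cycle_autD(1)[OF \<sigma>(1) k] \<sigma>(2) by auto
      also have "\<dots> \<longleftrightarrow> k = 1 \<or> cycle_adj l 1 k"
        using cycle_autD(2,3)[OF \<sigma>(1)] k l6 by auto
      also have "\<dots> \<longleftrightarrow> k \<le> 2"
        using k l6 by (auto simp: cycle_adj_iff_l)
      finally show "(v, g (\<sigma> k)) \<in> E \<longleftrightarrow> k \<le> 2" .
    qed
    from max[OF this] have "card (insert v (\<Union>i<l. K (\<sigma> i))) \<le> card (\<Union>i<l. K i)"
    proof -
      have "(\<Union>i<l. ((\<lambda>i. K (\<sigma> i))(1 := insert v (K (\<sigma> 1)))) i) = insert v (\<Union>i<l. K (\<sigma> i))"
        using l6 by (auto split: if_splits)
      with max[OF \<open>hole_ring ((\<lambda>i. K (\<sigma> i))(1 := insert v (K (\<sigma> 1))))\<close>] show ?thesis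
        by simp
    qed
    moreover have "finite (\<Union>i<l. K i)"
      using hole_ringD(1)[OF K] finite_V by (auto intro: finite_subset)
    ultimately have False
      unfolding aut(2) using v(2) by simp
    then show ?thesis ..
  qed
qed

section \<open>Paths attached to nonadjacent vertices of consecutive cliques\<close>

text \<open>The path \<open>p\<close> and the long arc from \<open>y\<close> to \<open>x\<close>
  form a hole, after cutting off \<open>y\<close> or \<open>x\<close> where an end of
  \<open>p\<close> also sees the next vertex of the arc. It has at least \<open>m + l - 2\<close>
  vertices, so \<open>m = 2\<close> and \<open>p 1\<close> sees \<open>h 2\<close>. Then
  \<open>p 1\<close> misses \<open>h 0\<close>, which sees both \<open>x\<close> and
  \<open>y\<close>, and a hole of length 4 or 5 appears.\<close>

lemma consecutive_attachments:
  assumes K: "hole_ring K" and h: "core K h" and x: "x \<in> K 0" and y: "y \<in> K 1" and xy: "(x, y) \<notin> E"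
    and p: "induced_path E m p" and m: "2 \<le> m"
    and out: "\<And>i. i < m \<Longrightarrow> p i \<notin> (\<Union>i<l. K i)"
    and att: "\<And>i i' s t. i \<le> i' \<Longrightarrow> i' < m \<Longrightarrow> s \<in> (\<Union>i<l. K i) \<Longrightarrow> t \<in> (\<Union>i<l. K i) \<Longrightarrow> (p i, s) \<in> E \<Longrightarrow>
      (p i', t) \<in> E \<Longrightarrow> s \<noteq> t \<Longrightarrow> (s, t) \<notin> E \<Longrightarrow> i = 0 \<and> i' = m - 1"
    and px: "(p 0, x) \<in> E" and py: "(p (m - 1), y) \<in> E"
  shows False
proof -
  have l: "0 < l" "1 < l" "2 < l" "l - 1 < l"
    using l6 by auto
  define q where "q = (\<lambda>d. if d = 0 then y else if d = l - 1 then x else h (Suc d))"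
  have q: "induced_path E l q"
    unfolding q_def by (rule ring_arc[OF K h x y xy])
  have q0: "q 0 = y" and q1: "q (l - Suc 0) = x" and q2: "0 < d \<Longrightarrow> d < l - 1 \<Longrightarrow> q d = h (Suc d)" for d
    unfolding q_def using l by auto
  \<comment> \<open>First and last index of the arc \<open>q\<close> that is used. Since
    \<open>q d\<close> is \<open>h (Suc d)\<close> inside the arc, \<open>h 2\<close> has index 1
    and \<open>h (l - 1)\<close> has index \<open>l - 2\<close>.\<close>
  define s where "s = (if (p (m - 1), h 2) \<in> E then 1 else 0 :: nat)"
  define e where "e = (if (p 0, h (l - 1)) \<in> E then l - 2 else l - 1)"
  have hK: "h k \<in> K k" if "k < l" for k
    using coreD(1)[OF h that] .
  have W: "u \<in> (\<Union>i<l. K i)" if "u \<in> K k" "k < l" for u k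
    using that by auto
  have xyW: "x \<in> (\<Union>i<l. K i)" "y \<in> (\<Union>i<l. K i)" "x \<noteq> y"
    using W x y l hole_ringD(4)[OF K l(1,2) x] by auto
  have mm: "m - 1 < m" "0 < m" "m - 1 \<noteq> 0"
    using m by auto
  have nad: "u \<noteq> w" "(u, w) \<notin> E" if "u \<in> K i" "w \<in> K j" "i < l" "j < l" "i \<noteq> j" "\<not> cycle_adj l i j" for u w i j
    using hole_ringD(4)[OF K that(3,4,1)] hole_ringD(5)[OF K that(3,4,1,2)] that by blast+
  have at0: "k = l - 1" if "(p 0, h k) \<in> E" "2 \<le> k" "k < l" for k
  proof (rule ccontr)
    assume "k \<noteq> l - 1"
    then have "\<not> cycle_adj l 0 k"
      using that by (auto simp: cycle_adj_iff_l)
    then have "x \<noteq> h k" "(x, h k) \<notin> E"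
      using nad[OF x hK[OF that(3)] l(1) that(3)] that by auto
    then show False
      using att[of 0 0 x "h k"] W[OF hK] that xyW px mm by auto
  qed
  have at1: "k = 2" if "(p (m - 1), h k) \<in> E" "2 \<le> k" "k < l" for k
  proof (rule ccontr)
    assume "k \<noteq> 2"
    then have "\<not> cycle_adj l 1 k"
      using that by (auto simp: cycle_adj_iff_l)
    then have "y \<noteq> h k" "(y, h k) \<notin> E"
      using nad[OF y hK[OF that(3)] l(2) that(3)] that by auto
    then show False
      using att[of "m - 1" "m - 1" y "h k"] W[OF hK] that xyW py mm by auto
  qed
  have p0y: "(p 0, y) \<notin> E" and p1x: "(p (m - 1), x) \<notin> E"
    using att[of 0 0 x y] att[of "m - 1" "m - 1" x y] xyW xy px py mm by auto
  \<comment> \<open>By \<open>att\<close>, an attachment of an inner vertex would be equal or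
    adjacent to both \<open>x\<close> and \<open>y\<close>; no vertex of the arc is.\<close>
  have int: "(p i, u) \<notin> E" if iu: "0 < i" "i < m - 1" "u = x \<or> u = y \<or> (\<exists>k. 2 \<le> k \<and> k < l \<and> u = h k)" for i u
  proof
    assume pu: "(p i, u) \<in> E"
    have im: "i < m" "i \<noteq> 0" "i \<noteq> m - 1" "0 \<le> i" "i \<le> m - 1"
      using that by auto
    have uW: "u \<in> (\<Union>i<l. K i)"
      using that(3) xyW W[OF hK] by auto
    have xu: "u = x \<or> (x, u) \<in> E" and uy: "u = y \<or> (u, y) \<in> E"
      using att[OF im(4,1) xyW(1) uW px pu] att[OF im(5) mm(1) uW xyW(2) pu py] im by auto
    then have "u \<noteq> x" "u \<noteq> y"
      using xy xyW(3) by auto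
    then obtain k where k: "2 \<le> k" "k < l" "u = h k"
      using iu(3) by blast
    have "\<not> cycle_adj l 0 k \<or> \<not> cycle_adj l 1 k"
      using k l6 by (auto simp: cycle_adj_iff_l)
    then show False
      using nad[OF x hK[OF k(2)] l(1) k(2)] nad[OF y hK[OF k(2)] l(2) k(2)] k xu uy
        adj_commute[of u y] \<open>u \<noteq> x\<close> \<open>u \<noteq> y\<close> by auto
  qed
  have se: "s \<le> 1" "l - 2 \<le> e" "e \<le> l - 1" "s < e"
    unfolding s_def e_def using l6 by auto
  have "m + (e - s + 1) = l"
  proof (rule join_paths[OF p induced_path_shift[OF q]])
    fix i d assume id: "i < m" "d < e - s + 1"
    define k where "k = s + d"
    have k: "s \<le> k" "k \<le> e" "k < l" "d = 0 \<longleftrightarrow> k = s" "d = e - s + 1 - 1 \<longleftrightarrow> k = e"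
      using id se unfolding k_def by auto
    have qW: "q k \<in> (\<Union>i<l. K i)"
      unfolding q_def using xyW W[OF hK, of "Suc k"] k(3) by auto
    then have "p i \<noteq> q k"
      using out[OF id(1)] by metis
    moreover have "(p i, q k) \<in> E \<longleftrightarrow> i = m - 1 \<and> k = s \<or> i = 0 \<and> k = e"
    proof -
      have k_cases: "k = 0 \<or> k = l - 1 \<or> 0 < k \<and> k < l - 1"
        using k(3) by auto
      consider "i = 0" | "i = m - 1" | "0 < i" "i < m - 1"
        using id(1) by linarith
      then show ?thesis
      proof cases
        case 1
        have "(p 0, q k) \<in> E \<longleftrightarrow> k = e"
          using k_cases
        proof (elim disjE conjE)
          assume *: "0 < k" "k < l - 1"
          show ?thesis
          proof (cases "k = l - 2")
            case True
            then have "Suc k = l - 1"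
              using l6 by auto
            then show ?thesis
              using True * q2 unfolding e_def by auto
          next
            case False
            then have "Suc k < l" "2 \<le> Suc k" "Suc k \<noteq> l - 1"
              using * by auto
            then have "(p 0, h (Suc k)) \<notin> E" "k \<noteq> e"
              using at0[of "Suc k"] False * unfolding e_def by auto
            then show ?thesis
              using * q2 by auto
          qed
        qed (use p0y px k(2) se l6 in \<open>auto simp: e_def q0 q1\<close>)
        with 1 mm show ?thesis by auto
      next
        case 2
        have "(p (m - 1), q k) \<in> E \<longleftrightarrow> k = s"
          using k_cases
        proof (elim disjE conjE)
          assume *: "0 < k" "k < l - 1"
          show ?thesis
          proof (cases "k = 1")
            case True
            then have "Suc k = 2"
              by auto
            then show ?thesis
              using True * q2 unfolding s_def by (auto simp: numeral_2_eq_2)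
          next
            case False
            then have "Suc k < l" "2 \<le> Suc k" "Suc k \<noteq> 2"
              using * by auto
            then have "(p (m - 1), h (Suc k)) \<notin> E" "k \<noteq> s"
              using at1[of "Suc k"] False * unfolding s_def by auto
            then show ?thesis
              using * q2 by auto
          qed
        qed (use p1x py k(1) se l6 in \<open>auto simp: s_def q0 q1\<close>)
        with 2 mm show ?thesis by auto
      next
        case 3
        have "q k = x \<or> q k = y \<or> (\<exists>k'. 2 \<le> k' \<and> k' < l \<and> q k = h k')"
          using k_cases
        proof (elim disjE conjE)
          assume "0 < k" "k < l - 1"
          then have "q k = h (Suc k)" "2 \<le> Suc k" "Suc k < l"
            using q2 by auto
          then show ?thesis by blast
        qed (use q0 q1 in auto)
        from int[OF 3 this] show ?thesis
          using 3 by auto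
      qed
    qed
    ultimately show "p i \<noteq> q (s + d) \<and> ((p i, q (s + d)) \<in> E \<longleftrightarrow>
        i = m - 1 \<and> d = 0 \<or> i = 0 \<and> d = e - s + 1 - 1)"
      unfolding k(4,5) k_def[symmetric] by blast
  qed (use se m l6 in \<open>linarith+\<close>)
  \<comment> \<open>With \<open>m \<ge> 2\<close> and at least \<open>l - 2\<close> vertices on the
    arc, a total of \<open>l\<close> leaves no slack.\<close>
  then have m2: "m = 2" "s = 1"
    using se m l6 by linarith+
  have "(p (m - 1), h 2) \<in> E"
  proof (rule ccontr)
    assume "(p (m - 1), h 2) \<notin> E"
    then have "s = 0"
      unfolding s_def by (rule if_not_P)
    with m2(2) show False by linarith
  qed
  then have ph: "(p 1, h 2) \<in> E"
    using m2(1) by simp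
  have c: "cycle_adj l 0 1" "cycle_adj l 1 0" "\<not> cycle_adj l 0 2"
    using l6 by (auto simp: cycle_adj_iff_l)
  have h0: "(h 0, y) \<in> E"
    using coreD(2)[OF h c(1) y] .
  then have "h 0 \<noteq> x"
    using xy by auto
  then have h0x: "(x, h 0) \<in> E"
    using hole_ringD(3)[OF K l(1) x hK[OF l(1)]] by auto
  have p1h: "(p 1, h 0) \<notin> E"
    using att[of 1 1 "h 0" "h 2"] nad[OF hK[OF l(1)] hK[OF l(3)] l(1,3) _ c(3)]
      W[OF hK[OF l(1)] l(1)] W[OF hK[OF l(3)] l(3)] ph m2(1) by auto
  have p01: "(p 0, p 1) \<in> E"
    using induced_pathD(2)[OF p, of 0 1] m2(1) by auto
  have ne: "p 0 \<noteq> y" "p 1 \<noteq> h 0"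
    using out[of 0] out[of 1] xyW(2) W[OF hK[OF l(1)] l(1)] m2(1) by auto
  show False
  proof (cases "(p 0, h 0) \<in> E")
    case True
    then show False
      using no_hole4[of "p 0" "h 0" y "p 1"] h0 py p01 p0y p1h ne m2(1) adj_commute by auto
  next
    case False
    then show False
      using no_hole5[of "p 0" x "h 0" y "p 1"] px h0x h0 py p01 p0y p1h p1x xy m2(1) adj_commute by auto
  qed
qed

section \<open>The decomposition\<close>

text \<open>Among all nonadjacent pairs of attachments, take one whose connecting walk in
  \<open>Q\<close> is shortest. If the walk is a single vertex, that vertex is complete to the ring,
  contrary to the choice of \<open>Q\<close>. Otherwise the pair lies in nonconsecutive cliques and
  yields mates, or in consecutive ones and is impossible.\<close>

lemma no_nonadjacent_attachments:
  assumes K: "hole_ring K" and nm: "\<not> mated"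
    and max: "\<And>K'. hole_ring K' \<Longrightarrow> card (\<Union>i<l. K' i) \<le> card (\<Union>i<l. K i)"
    and Q: "Q \<subseteq> V" "Q \<inter> (\<Union>i<l. K i) = {}" "\<And>v. v \<in> Q \<Longrightarrow> \<exists>u\<in>\<Union>i<l. K i. (v, u) \<notin> E"
    and x: "x \<in> (\<Union>i<l. K i)" "y \<in> (\<Union>i<l. K i)" "x \<noteq> y" "(x, y) \<notin> E"
    and u: "u \<in> Q" "u' \<in> Q" "(u, x) \<in> E" "(u', y) \<in> E" "(u, u') \<in> (induced E Q)\<^sup>*"
  shows False
proof -
  let ?W = "\<Union>i<l. K i"
  \<comment> \<open>The walk length is minimised over all quadruples, not just for the given pair;
    only this makes \<open>att\<close> available. The names \<open>x\<close>, \<open>y\<close>,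
    \<open>u\<close>, \<open>u'\<close> are rebound to a minimal quadruple below.\<close>
  define P where "P n x y u u' \<longleftrightarrow> x \<in> ?W \<and> y \<in> ?W \<and> x \<noteq> y \<and> (x, y) \<notin> E \<and> u \<in> Q \<and> u' \<in> Q \<and>
    (u, x) \<in> E \<and> (u', y) \<in> E \<and> (u, u') \<in> induced E Q ^^ n" for n x y u u'
  obtain n0 where "P n0 x y u u'"
    using x u unfolding P_def rtrancl_power by blast
  then have ex: "\<exists>n x y u u'. P n x y u u'"
    by blast
  define n where "n = (LEAST n. \<exists>x y u u'. P n x y u u')"
  have "\<exists>x y u u'. P n x y u u'"
    unfolding n_def using ex by (rule LeastI_ex)
  then obtain x y u u' where P: "P n x y u u'"
    by blast
  have least: "n \<le> k" if "P k a b c d" for k a b c d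
    unfolding n_def using that by (intro Least_le) blast
  have xy: "x \<in> ?W" "y \<in> ?W" "x \<noteq> y" "(x, y) \<notin> E" "u \<in> Q" "u' \<in> Q" "(u, x) \<in> E" "(u', y) \<in> E"
    and uu: "(u, u') \<in> induced E Q ^^ n"
    using P unfolding P_def by auto
  have "(u, u') \<in> (induced E Q)\<^sup>*"
    using uu rtrancl_power by blast
  then obtain p where p: "p 0 = u" "p (graph_dist (induced E Q) u u') = u'"
    "\<And>i. i \<le> graph_dist (induced E Q) u u' \<Longrightarrow> p i \<in> Q"
    "induced_path E (Suc (graph_dist (induced E Q) u u')) p"
    using shortest_path[OF _ xy(5)] by blast
  have seg: "(p i, p j) \<in> induced E Q ^^ (j - i)" if "i \<le> j" "j \<le> graph_dist (induced E Q) u u'" for i j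
    unfolding relpow_fun_conv
  proof (intro exI[of _ "\<lambda>k. p (i + k)"] conjI allI impI)
    fix k assume "k < j - i"
    then show "(p (i + k), p (i + Suc k)) \<in> induced E Q"
      using induced_pathD(2)[OF p(4), of "i + k" "i + Suc k"] p(3) that unfolding induced_def by auto
  qed (use that in auto)
  have "graph_dist (induced E Q) u u' = n"
  proof (rule antisym)
    show "graph_dist (induced E Q) u u' \<le> n"
      unfolding graph_dist_def using uu by (rule Least_le)
    show "n \<le> graph_dist (induced E Q) u u'"
      using least[of _ x y u u'] seg[of 0 "graph_dist (induced E Q) u u'"] p(1,2) xy unfolding P_def by auto
  qed
  note p = p[unfolded this] and seg = seg[unfolded this]
  \<comment> \<open>Any other nonadjacent attachments along the path would be joined by a proper
    segment of it, against minimality.\<close>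
  have att: "i = 0 \<and> j = n" if ij: "i \<le> j" "j \<le> n" and s: "s \<in> ?W" "t \<in> ?W" "(p i, s) \<in> E" "(p j, t) \<in> E"
    "s \<noteq> t" "(s, t) \<notin> E" for i j s t
  proof -
    have "P (j - i) s t (p i) (p j)"
      using s seg[OF ij] p(3) ij unfolding P_def by auto
    from least[OF this] show ?thesis
      using ij by auto
  qed
  obtain h where h: "core K h"
    using core_exists[OF K] .
  have "n \<noteq> 0"
  proof
    assume "n = 0"
    then have "u = u'"
      using p(1,2) by simp
    then have "\<forall>w\<in>?W. (u, w) \<in> E"
      using complete_if_nonadjacent_nbrs[OF K nm max _ _ xy(1-4,7)] xy(5,8) Q(1,2) by blast
    then show False
      using Q(3)[OF xy(5)] by blast
  qed
  then have m: "2 \<le> Suc n"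
    by auto
  obtain i j where ij: "x \<in> K i" "i < l" "y \<in> K j" "j < l"
    using xy by auto
  have "i \<noteq> j"
    using hole_ringD(3)[OF K ij(2,1)] ij(3) xy by auto
  have pW: "p k \<notin> ?W" if "k < Suc n" for k
    using p(3)[of k] that Q(2) by auto
  show False
  proof (cases "cycle_adj l i j")
    case False
    let ?g = "h(i := x, j := y)"
    have g: "hole_map ?g"
      by (rule hole_map_core_update2[OF K h ij(2,1,4,3) \<open>i \<noteq> j\<close> False])
    have gW: "?g k \<in> ?W" if "k < l" for k
      using that xy(1,2) coreD(1)[OF h] by auto
    have mated
    proof (rule mated_if_path[OF g p(4) m])
      show "p k \<noteq> ?g k'" if "k < Suc n" "k' < l" for k k'
        using pW[OF that(1)] gW[OF that(2)] by metis
      show "a = 0 \<and> b = Suc n - 1"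
        if "a \<le> b" "b < Suc n" "s < l" "t < l" "(p a, ?g s) \<in> E" "(p b, ?g t) \<in> E" "s \<noteq> t" "\<not> cycle_adj l s t"
        for a b s t
        using att[OF that(1) _ gW[OF that(3)] gW[OF that(4)] that(5,6)] hole_mapD[OF g that(3,4)] that by simp
      show "(p 0, ?g i) \<in> E" "(p (Suc n - 1), ?g j) \<in> E"
        using p(1,2) xy(7,8) \<open>i \<noteq> j\<close> by simp_all
    qed (use ij \<open>i \<noteq> j\<close> False in auto)
    with nm show False by (rule notE)
  next
    case True
    obtain \<sigma> where \<sigma>: "cycle_aut l \<sigma>" "\<sigma> 0 = i" "\<sigma> 1 = j"
      using cycle_aut_exists[OF _ True] l6 by auto
    note aut = hole_ring_aut[OF K \<sigma>(1)]
    show False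
    proof (rule consecutive_attachments[OF aut(1) core_aut[OF h \<sigma>(1)] _ _ xy(4) p(4) m])
      show "p k \<notin> (\<Union>i<l. K (\<sigma> i))" if "k < Suc n" for k
        unfolding aut(2) using pW[OF that] .
      show "a = 0 \<and> b = Suc n - 1"
        if "a \<le> b" "b < Suc n" "s \<in> (\<Union>i<l. K (\<sigma> i))" "t \<in> (\<Union>i<l. K (\<sigma> i))"
          "(p a, s) \<in> E" "(p b, t) \<in> E" "s \<noteq> t" "(s, t) \<notin> E" for a b s t
        using att[OF that(1) _ _ _ that(5-8)] that(2-4) unfolding aut(2) by simp
    qed (use ij \<sigma> p(1,2) xy(7,8) in auto)
  qed
qed

lemma ring_if_hole:
  assumes "hole V E c"
  shows "hole_ring (\<lambda>i. {c ! i})"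
proof -
  have len: "length c = l"
    using assms mono unfolding monoholed_def by blast
  have c: "distinct c" "set c \<subseteq> V"
    and adj: "\<And>i j. i < l \<Longrightarrow> j < l \<Longrightarrow> (c ! i, c ! j) \<in> E \<longleftrightarrow> cycle_adj l i j"
    using assms len unfolding hole_def by auto
  have "c ! i \<noteq> c ! j" if "i < l" "j < l" "i \<noteq> j" for i j
    using c(1) len that nth_eq_iff_index_eq by blast
  moreover have "c ! i \<in> V" if "i < l" for i
    using c(2) len that nth_mem by blast
  ultimately show ?thesis
    unfolding hole_ring_def clique_def using adj by auto
qed

lemma inflated_hole_if_indecomposable:
  assumes nm: "\<not> mated" and nc: "\<not> chordal V E" and ncut: "\<And>X. \<not> clique_cutset V E X"
    and nu: "\<not> (\<exists>v\<in>V. \<forall>u\<in>V. u \<noteq> v \<longrightarrow> (v, u) \<in> E)"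
  shows "inflated_hole l V E"
proof -
  obtain c where "hole V E c"
    using nc unfolding chordal_def by blast
  then have ex: "hole_ring (\<lambda>i. {c ! i})"
    by (rule ring_if_hole)
  have bound: "card (\<Union>i<l. K i) \<le> card V" if "hole_ring K" for K
    using hole_ringD(1)[OF that] finite_V by (intro card_mono) auto
  have "\<exists>K. hole_ring K \<and> (\<forall>K'. hole_ring K' \<longrightarrow> card (\<Union>i<l. K' i) \<le> card (\<Union>i<l. K i))"
    by (rule ex_has_greatest_nat[where P = hole_ring and b = "Suc (card V)", OF ex]) (use bound in \<open>auto simp: less_Suc_eq_le\<close>)
  then obtain K where K: "hole_ring K"
    and max: "\<And>K'. hole_ring K' \<Longrightarrow> card (\<Union>i<l. K' i) \<le> card (\<Union>i<l. K i)"
    by blast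
  define W where "W = (\<Union>i<l. K i)"
  define U where "U = {v \<in> V - W. \<forall>u\<in>W. (v, u) \<in> E}"
  define Q where "Q = V - W - U"
  obtain h where h: "core K h"
    using core_exists[OF K] .
  have WV: "W \<subseteq> V"
    unfolding W_def using hole_ringD(1)[OF K] by auto
  have hl: "0 < l" "2 < l" and c02: "\<not> cycle_adj l 0 2"
    using l6 by (auto simp: cycle_adj_iff_l)
  have hW: "h 0 \<in> W" "h 2 \<in> W"
    using coreD(1)[OF h] hl unfolding W_def by blast+
  have h02: "(h 0, h 2) \<notin> E" "h 0 \<noteq> h 2"
    using hole_mapD[OF hole_map_core_self[OF K h] hl] c02 by auto
  \<comment> \<open>Two nonadjacent vertices of \<open>U\<close> would form a hole of length 4 with
    \<open>h 0\<close> and \<open>h 2\<close>.\<close>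
  have Ucl: "clique E U"
    unfolding clique_def
  proof (intro ballI impI, rule ccontr)
    fix v v' assume v: "v \<in> U" "v' \<in> U" "v \<noteq> v'" "(v, v') \<notin> E"
    then show False
      using no_hole4[of v "h 0" v' "h 2"] hW h02 adj_commute unfolding U_def by auto
  qed
  have "Q = {}"
  proof (rule ccontr)
    assume "Q \<noteq> {}"
    then obtain v0 where v0: "v0 \<in> Q"
      by auto
    \<comment> \<open>The component of \<open>v0\<close> in the graph induced on \<open>Q\<close>,
      with \<open>A\<close> its attachments in the ring.\<close>
    define C where "C = {v. (v0, v) \<in> (induced E Q)\<^sup>*}"
    have CQ: "v \<in> Q" if "v \<in> C" for v
      using that v0 unfolding C_def induced_def by (auto elim: rtranclE)
    define A where "A = {w \<in> W. \<exists>v\<in>C. (v, w) \<in> E}"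
    have Q3: "\<exists>u\<in>W. (v, u) \<notin> E" if "v \<in> Q" for v
      using that unfolding Q_def U_def by auto
    have Acl: "(x, y) \<in> E" if xy: "x \<in> A" "y \<in> A" "x \<noteq> y" for x y
    proof (rule ccontr)
      assume n: "(x, y) \<notin> E"
      obtain u u' where u: "u \<in> C" "(u, x) \<in> E" "u' \<in> C" "(u', y) \<in> E"
        using xy unfolding A_def by auto
      have "(u, u') \<in> (induced E Q)\<^sup>*"
        using u(1,3) rtrancl_induced_commute[OF sym_E] unfolding C_def by (auto intro: rtrancl_trans)
      then show False
        using no_nonadjacent_attachments[OF K nm max, of Q x y u u'] Q3 xy n u CQ
        unfolding W_def[symmetric] Q_def A_def by auto
    qed
    have "clique E (A \<union> U)"
      using Acl Ucl adj_commute unfolding clique_def A_def U_def by blast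
    moreover have "A \<union> U \<subseteq> V"
      using WV unfolding A_def U_def by auto
    moreover have "\<not> connected_graph (V - (A \<union> U)) (induced E (V - (A \<union> U)))"
    proof
      assume con: "connected_graph (V - (A \<union> U)) (induced E (V - (A \<union> U)))"
      \<comment> \<open>The clique \<open>A\<close> cannot contain both \<open>h 0\<close> and
        \<open>h 2\<close>, so some vertex of the ring survives the deletion, and it is to be
        separated from \<open>v0\<close>.\<close>
      obtain w where w: "w \<in> W" "w \<notin> A"
        using Acl hW h02 by blast
      then have "w \<in> V - (A \<union> U)" "v0 \<in> V - (A \<union> U)"
        using WV v0 unfolding U_def Q_def A_def by auto
      then have "(v0, w) \<in> (induced E (V - (A \<union> U)))\<^sup>*"
        using con unfolding connected_graph_def by auto
      \<comment> \<open>A walk avoiding \<open>A \<union> U\<close> cannot leave \<open>C\<close>: a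
        step into the ring would end in \<open>A\<close>, and every other remaining vertex is in
        \<open>Q\<close>.\<close>
      then have "w \<in> C"
      proof (induction rule: rtrancl_induct)
        case base
        then show ?case unfolding C_def by auto
      next
        case (step y z)
        then have yz: "(y, z) \<in> E" "z \<in> V" "z \<notin> A" "z \<notin> U"
          unfolding induced_def by auto
        then have "z \<notin> W"
          using step.IH unfolding A_def by auto
        then have "(y, z) \<in> induced E Q"
          using yz CQ[OF step.IH] unfolding induced_def Q_def by auto
        then show ?case
          using step.IH unfolding C_def by (auto intro: rtrancl_into_rtrancl)
      qed
      then show False
        using CQ w(1) unfolding Q_def by auto
    qed
    ultimately have "clique_cutset V E (A \<union> U)"
      unfolding clique_cutset_def by auto
    with ncut show False by blast
  qed
  then have V: "V = W \<union> U"
    using WV unfolding Q_def U_def by auto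
  have "U = {}"
  proof (rule ccontr)
    assume "U \<noteq> {}"
    then obtain v where "v \<in> U"
      by auto
    then have "v \<in> V" "\<forall>u\<in>V. u \<noteq> v \<longrightarrow> (v, u) \<in> E"
      using Ucl unfolding V clique_def by (auto simp: U_def)
    with nu show False by blast
  qed
  then show ?thesis
    using ring_inflated[OF K] V unfolding W_def by simp
qed

end

theorem theorem3p6:
  fixes l :: nat and V :: "'a set" and E :: "'a rel"
  assumes "6 \<le> l"
    and "simple_graph V E"
    and "monoholed l V E"
  shows "(\<exists>v\<in>V. \<forall>u\<in>V. u \<noteq> v \<longrightarrow> (v, u) \<in> E)
    \<or> (\<exists>X. clique_cutset V E X)
    \<or> chordal V E
    \<or> inflated_hole l V E
    \<or> (\<exists>k\<ge>3. \<exists>S S' T. S \<subseteq> V \<and> S' \<subseteq> V \<and> mated_spiders l k E S S' T)"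
proof -
  interpret monoholed_graph l V E
    by unfold_locales (rule assms)+
  show ?thesis
    using inflated_hole_if_indecomposable by blast
qed

end
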